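(* Let $(X,T,\mu)$ be a probability measure preserving dynamical system defined on a smooth manifold $X$ which satisfies the multiple decorrelation property (MD) described in the context. Let $\theta:x\mapsto\theta_x$ be a map from $X$ to the set of Hölder continuous maps from $X$ to $X$ such that, for some $\eta>0$ and $C>0$, $$\sup_{z\in X}d(\theta_x(z),\theta_y(z))\le C\,d(x,y)^\eta\qquad\text{for all }x,y\in X.$$ Then for every centered real-valued Hölder continuous function $\varphi$ on $X$ and every $t\in\mathbb{R}$, $$\mathbb{E}\Big[\exp\Big(i\frac{t}{\sqrt n}\sum_{k=0}^{n-1}\big(\varphi(\theta_x(T^kx))-\overline{\varphi}_{\theta_x}\big)\Big)\Big]\longrightarrow\int_X\exp\Big(-\frac12\sigma^2_{\theta_x}t^2\Big)\,d\mu(x)\qquad(n\to\infty),$$ where the expectation is with respect to the variable $x$ distributed according to $\mu$.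
   Context: $d$ is a Riemannian distance on $X$; $\mathbb{E}$ is the integral with respect to $\mu$; a function is centered if its $\mu$-integral is $0$; $T^kf:=f\circ T^k$; $\mathrm{Cov}(f,g)=\mathbb{E}(fg)-\mathbb{E}(f)\mathbb{E}(g)$. For $\eta>0$, $[f]_\eta=\sup_{x\neq y}\frac{|f(x)-f(y)|}{d(x,y)^\eta}$ and $\|f\|_\eta=\|f\|_\infty+[f]_\eta$; $f$ is $\eta$-Hölder if $\|f\|_\eta<\infty$. Property (MD): for every Hölder exponent $\eta$ there exist $C>0$ and $\delta\in\,]0,1[$ such that, for all integers $m,m'$, all (complex-valued) $\eta$-Hölder continuous functions $(\varphi_i)_{i=1}^{m+m'}$ on $X$, all integers $0\le\ell_1\le\dots\le\ell_m\le k_1\le\dots\le k_{m'}$ and $N>0$, $$\Big|\mathrm{Cov}\Big(\prod_{i=1}^mT^{\ell_i}\varphi_i,\ \prod_{j=1}^{m'}T^{k_j+N}\varphi_{m+j}\Big)\Big|\le C\Big(\prod_{i=1}^{m+m'}\|\varphi_i\|_\infty+\sum_{j=1}^{m+m'}[\varphi_j]_\eta\prod_{i\ne j}\|\varphi_i\|_\infty\Big)\delta^N.$$ For a centered Hölder function $f$, the asymptotic variance is $\sigma(f)^2=\mu(f^2)+2\sum_{k=1}^\infty\langle f,T^kf\rangle$. Put $\overline{\varphi}_{\theta_x}:=\int_X\varphi(\theta_x(y))\,d\mu(y)$, $\varphi_{\theta_x}:=\varphi(\theta_x\,\cdot)-\overline{\varphi}_{\theta_x}$, and $\sigma^2_{\theta_x}:=\sigma^2(\varphi_{\theta_x})$.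 *)

theory Defs
  imports "HOL-Probability.Probability"
begin

section \<open>Smooth manifolds and Riemannian distances\<close>

text \<open>
  The manifold is a whole type. A chart is a pair of its domain (an open set) and a coordinate
  map into the model space \<^typ>\<open>'e::euclidean_space\<close>; values of the coordinate map outside the
  domain are irrelevant.
\<close>

type_synonym ('a, 'e) chart = "'a set \<times> ('a \<Rightarrow> 'e)"

text \<open>Class C-k on an open set, through the directional derivatives.\<close>

primrec C_k_on :: "nat \<Rightarrow> ('b::real_normed_vector \<Rightarrow> 'c::real_normed_vector) \<Rightarrow> 'b set \<Rightarrow> bool" where
  "C_k_on 0 f S \<longleftrightarrow> continuous_on S f"
| "C_k_on (Suc k) f S \<longleftrightarrow>
     (\<forall>x\<in>S. f differentiable (at x)) \<and>
     (\<forall>v. C_k_on k (\<lambda>x. frechet_derivative f (at x) v) S)"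

definition smooth_on :: "('b::real_normed_vector \<Rightarrow> 'c::real_normed_vector) \<Rightarrow> 'b set \<Rightarrow> bool" where
  "smooth_on f S \<longleftrightarrow> (\<forall>k. C_k_on k f S)"

definition chart_inv :: "('a, 'e) chart \<Rightarrow> 'e \<Rightarrow> 'a" where
  "chart_inv c = inv_into (fst c) (snd c)"

definition transition :: "('a, 'e) chart \<Rightarrow> ('a, 'e) chart \<Rightarrow> 'e \<Rightarrow> 'e" where
  "transition c c' = snd c' \<circ> chart_inv c"

definition smooth_atlas :: "('a::topological_space, 'e::euclidean_space) chart set \<Rightarrow> bool" where
  "smooth_atlas A \<longleftrightarrow>
     (\<forall>c\<in>A. open (fst c) \<and> open (snd c ` fst c) \<and>
        homeomorphism (fst c) (snd c ` fst c) (snd c) (chart_inv c)) \<and>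
     (\<Union>c\<in>A. fst c) = UNIV \<and>
     (\<forall>c\<in>A. \<forall>c'\<in>A. smooth_on (transition c c') (snd c ` (fst c \<inter> fst c')))"

text \<open>
  A Riemannian metric in coordinates: \<^term>\<open>g c x\<close> is the inner product of the tangent space at
  \<^term>\<open>x\<close>, expressed in the coordinates of the chart \<^term>\<open>c\<close>.
\<close>

definition riemannian_metric ::
  "('a::topological_space, 'e::euclidean_space) chart set \<Rightarrow>
   (('a, 'e) chart \<Rightarrow> 'a \<Rightarrow> 'e \<Rightarrow> 'e \<Rightarrow> real) \<Rightarrow> bool" where
  "riemannian_metric A g \<longleftrightarrow>
     (\<forall>c\<in>A. \<forall>x\<in>fst c. bilinear (g c x) \<and> (\<forall>v w. g c x v w = g c x w v) \<and>
        (\<forall>v. v \<noteq> 0 \<longrightarrow> g c x v v > 0)) \<and>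
     (\<forall>c\<in>A. \<forall>v w. smooth_on (\<lambda>p. g c (chart_inv c p) v w) (snd c ` fst c)) \<and>
     (\<forall>c\<in>A. \<forall>c'\<in>A. \<forall>x\<in>fst c \<inter> fst c'. \<forall>v w.
        g c x v w =
          g c' x (frechet_derivative (transition c c') (at (snd c x)) v)
                 (frechet_derivative (transition c c') (at (snd c x)) w))"

definition C1_curve ::
  "('a::topological_space, 'e::euclidean_space) chart set \<Rightarrow> real \<Rightarrow> real \<Rightarrow> (real \<Rightarrow> 'a) \<Rightarrow> bool" where
  "C1_curve A a b \<gamma> \<longleftrightarrow> continuous_on {a..b} \<gamma> \<and>
     (\<forall>c\<in>A. \<exists>D. continuous_on {t\<in>{a..b}. \<gamma> t \<in> fst c} D \<and>
        (\<forall>t\<in>{a..b}. \<gamma> t \<in> fst c \<longrightarrow>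
           ((snd c \<circ> \<gamma>) has_vector_derivative D t) (at t within {a..b})))"

text \<open>
  The library's \<^const>\<open>piecewise_C1_differentiable_on\<close> allows the derivative to blow up at the
  break points; here every piece is of class C1 up to its end points, so that the speed
  is bounded and the length integral below always exists.
\<close>

definition piecewise_C1_curve ::
  "('a::topological_space, 'e::euclidean_space) chart set \<Rightarrow> (real \<Rightarrow> 'a) \<Rightarrow> bool" where
  "piecewise_C1_curve A \<gamma> \<longleftrightarrow>
     (\<exists>(N::nat) s. s 0 = 0 \<and> s N = 1 \<and>
        (\<forall>i<N. s i < s (Suc i) \<and> C1_curve A (s i) (s (Suc i)) \<gamma>))"

text \<open>
  The speed does not depend on the chart chosen, except at the finitely many break points, which
  do not contribute to the length.
\<close>

definition speed ::
  "('a::topological_space, 'e::euclidean_space) chart set \<Rightarrow>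
   (('a, 'e) chart \<Rightarrow> 'a \<Rightarrow> 'e \<Rightarrow> 'e \<Rightarrow> real) \<Rightarrow> (real \<Rightarrow> 'a) \<Rightarrow> real \<Rightarrow> real" where
  "speed A g \<gamma> t =
     (let c = (SOME c. c \<in> A \<and> \<gamma> t \<in> fst c);
          v = vector_derivative (snd c \<circ> \<gamma>) (at t within {0..1})
      in sqrt (g c (\<gamma> t) v v))"

definition curve_length ::
  "('a::topological_space, 'e::euclidean_space) chart set \<Rightarrow>
   (('a, 'e) chart \<Rightarrow> 'a \<Rightarrow> 'e \<Rightarrow> 'e \<Rightarrow> real) \<Rightarrow> (real \<Rightarrow> 'a) \<Rightarrow> real" where
  "curve_length A g \<gamma> = integral {0..1} (speed A g \<gamma>)"

definition riemannian_distance ::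
  "('a::topological_space, 'e::euclidean_space) chart set \<Rightarrow>
   (('a, 'e) chart \<Rightarrow> 'a \<Rightarrow> 'e \<Rightarrow> 'e \<Rightarrow> real) \<Rightarrow> 'a \<Rightarrow> 'a \<Rightarrow> real" where
  "riemannian_distance A g x y =
     Inf {curve_length A g \<gamma> | \<gamma>. piecewise_C1_curve A \<gamma> \<and> \<gamma> 0 = x \<and> \<gamma> 1 = y}"

text \<open>
  The metric of the type is the Riemannian distance. Connectedness is what makes that distance
  finite; Hausdorffness and second countability come from the sort of the type.
\<close>

definition riemannian_manifold ::
  "('a::{metric_space, second_countable_topology}, 'e::euclidean_space) chart set \<Rightarrow>
   (('a, 'e) chart \<Rightarrow> 'a \<Rightarrow> 'e \<Rightarrow> 'e \<Rightarrow> real) \<Rightarrow> bool" where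
  "riemannian_manifold A g \<longleftrightarrow>
     smooth_atlas A \<and> riemannian_metric A g \<and> connected (UNIV :: 'a set) \<and>
     (\<forall>x y. dist x y = riemannian_distance A g x y)"


section \<open>Hoelder functions\<close>

definition sup_norm :: "('a \<Rightarrow> 'b::real_normed_vector) \<Rightarrow> real" where
  "sup_norm f = (SUP x. norm (f x))"

definition hoelder_quotients :: "real \<Rightarrow> ('a::metric_space \<Rightarrow> 'b::metric_space) \<Rightarrow> real set" where
  "hoelder_quotients \<eta> f = {dist (f x) (f y) / dist x y powr \<eta> | x y. x \<noteq> y}"

definition hoelder_seminorm :: "real \<Rightarrow> ('a::metric_space \<Rightarrow> 'b::metric_space) \<Rightarrow> real" where
  "hoelder_seminorm \<eta> f = Sup (hoelder_quotients \<eta> f)"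

text \<open>Finiteness of the Hoelder norm, that is, of both suprema above.\<close>

definition hoelder :: "real \<Rightarrow> ('a::metric_space \<Rightarrow> 'b::real_normed_vector) \<Rightarrow> bool" where
  "hoelder \<eta> f \<longleftrightarrow> bdd_above (range (\<lambda>x. norm (f x))) \<and> bdd_above (hoelder_quotients \<eta> f)"

definition hoelder_continuous :: "('a::metric_space \<Rightarrow> 'b::real_normed_vector) \<Rightarrow> bool" where
  "hoelder_continuous f \<longleftrightarrow> (\<exists>\<eta>>0. hoelder \<eta> f)"

text \<open>For maps into a metric space there is no boundedness requirement.\<close>

definition hoelder_map :: "('a::metric_space \<Rightarrow> 'b::metric_space) \<Rightarrow> bool" where
  "hoelder_map f \<longleftrightarrow> (\<exists>\<eta>>0. bdd_above (hoelder_quotients \<eta> f))"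


section \<open>Dynamical systems\<close>

text \<open>The sigma-algebra may be the Borel one or larger, e.g. its completion.\<close>

definition pmp_system :: "'a::topological_space measure \<Rightarrow> ('a \<Rightarrow> 'a) \<Rightarrow> bool" where
  "pmp_system M T \<longleftrightarrow>
     prob_space M \<and> space M = UNIV \<and> sets borel \<subseteq> sets M \<and>
     T \<in> measurable M M \<and> distr M M T = M"

definition Cov :: "'a measure \<Rightarrow> ('a \<Rightarrow> complex) \<Rightarrow> ('a \<Rightarrow> complex) \<Rightarrow> complex" where
  "Cov M f g = (LINT x|M. f x * g x) - (LINT x|M. f x) * (LINT x|M. g x)"

definition multiple_decorrelation :: "'a::metric_space measure \<Rightarrow> ('a \<Rightarrow> 'a) \<Rightarrow> bool" where
  "multiple_decorrelation M T \<longleftrightarrow>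
     (\<forall>\<eta>>0. \<exists>C>0. \<exists>\<delta>\<in>{0<..<1}.
        \<forall>(m::nat) (m'::nat) (\<phi> :: nat \<Rightarrow> 'a \<Rightarrow> complex) (l :: nat \<Rightarrow> nat) (k :: nat \<Rightarrow> nat) (N::nat).
          (\<forall>i\<in>{1..m+m'}. hoelder \<eta> (\<phi> i)) \<longrightarrow>
          mono_on {1..m} l \<longrightarrow> mono_on {1..m'} k \<longrightarrow>
          (\<forall>i\<in>{1..m}. \<forall>j\<in>{1..m'}. l i \<le> k j) \<longrightarrow> N > 0 \<longrightarrow>
          cmod (Cov M (\<lambda>x. \<Prod>i=1..m. \<phi> i ((T ^^ l i) x))
                      (\<lambda>x. \<Prod>j=1..m'. \<phi> (m + j) ((T ^^ (k j + N)) x)))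
            \<le> C * ((\<Prod>i=1..m+m'. sup_norm (\<phi> i)) +
                   (\<Sum>j=1..m+m'. hoelder_seminorm \<eta> (\<phi> j) *
                      (\<Prod>i\<in>{1..m+m'} - {j}. sup_norm (\<phi> i)))) * \<delta> ^ N)"

text \<open>
  The usual series starts at 1, the one here at 0; hence the \<^const>\<open>Suc\<close>.
\<close>

definition asymptotic_variance :: "'a measure \<Rightarrow> ('a \<Rightarrow> 'a) \<Rightarrow> ('a \<Rightarrow> real) \<Rightarrow> real" where
  "asymptotic_variance M T f =
     (LINT x|M. (f x)\<^sup>2) + 2 * (\<Sum>k. LINT x|M. f x * f ((T ^^ Suc k) x))"

definition space_mean :: "'a measure \<Rightarrow> ('a \<Rightarrow> real) \<Rightarrow> ('a \<Rightarrow> 'a) \<Rightarrow> real" where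
  "space_mean M \<phi> \<theta> = (LINT y|M. \<phi> (\<theta> y))"

definition centered_comp :: "'a measure \<Rightarrow> ('a \<Rightarrow> real) \<Rightarrow> ('a \<Rightarrow> 'a) \<Rightarrow> 'a \<Rightarrow> real" where
  "centered_comp M \<phi> \<theta> = (\<lambda>y. \<phi> (\<theta> y) - space_mean M \<phi> \<theta>)"

end

theory Submission
  imports Defs "HOL-Real_Asymp.Real_Asymp"
begin

text \<open>
  Write \<open>F\<^sub>n(y, x)\<close> for the exponential with the parameter \<open>y\<close> of \<open>\<theta>\<close> separated from the starting
  point \<open>x\<close> of the orbit.

  For fixed \<open>y\<close>, the integral of \<open>F\<^sub>n(y, \<cdot>)\<close> converges by the central limit theorem for a single
  Hoelder observable. With \<open>s = t / \<surd>n\<close> and \<open>\<Phi>(m)\<close> the characteristic function of the \<open>m\<close>-th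
  Birkhoff sum at \<open>s\<close>, a second order expansion and (MD) across gaps of length \<open>g \<approx> n\<^bsup>1/8\<^esup>\<close> give
  \<open>\<Phi>(m + 1) = (1 - s\<^sup>2\<sigma>\<^sup>2/2) \<Phi>(m) + o(1/n)\<close>, uniformly in \<open>2g \<le> m < n\<close>.

  To replace the diagonal \<open>F\<^sub>n(x, x)\<close> by independent \<open>y\<close> and \<open>x\<close>, drop the first \<open>g\<close> terms of the sum
  and localise \<open>y\<close> by a partition of unity at a scale \<open>n\<^bsup>-a\<^esup>\<close> so small that freezing \<open>y\<close> in a cell
  changes \<open>F\<^sub>n\<close> by \<open>o(1)\<close>. Each cell is decorrelated at the cost of a power of \<open>n\<close> times \<open>\<delta>\<^bsup>g\<^esup>\<close>, and
  the number of cells is polynomial in \<open>n\<close> on a set of measure close to \<open>1\<close>: this is where the finite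
  dimension of the manifold enters. The same set is chosen so that the observables are Hoelder
  with a common exponent and constant, since the constants in (MD) depend on the exponent.
\<close>

section \<open>Covering numbers of Riemannian manifolds\<close>

text \<open>The bound in (MD) is linear in the Hoelder seminorms and costs nothing else per factor.
  So the exponential of a Birkhoff sum is handled as a product of n unimodular factors with
  seminorms of order |s|, and a member of the partition as a product of tents of slope 1/\<epsilon>.
  All constants are then polynomial in n, and \<delta>^g with g a power of n beats every polynomial.
  Within these limits g must stay small: the Taylor errors of n steps add up to order g^2 / sqrt n,
  which forces an exponent below 1/4, and 1/8 is one choice. The obstacle is that the parameter and
  the orbit start from the same random point, and that the Hoelder exponent of the observable varies
  with this point without any bound. The limit theorem is therefore proved for one parameter at a
  time, with rates depending on it; the characteristic functions are bounded by 1, so dominated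
  convergence integrates over the parameter. Uniformity is needed in the decoupling alone, where a
  set of small measure may be discarded.\<close>

lemma speed_nonneg:
  assumes "smooth_atlas A" "riemannian_metric A g"
  shows "speed A g \<gamma> t \<ge> 0"
proof -
  define c where "c = (SOME c. c \<in> A \<and> \<gamma> t \<in> fst c)"
  have "\<exists>c. c \<in> A \<and> \<gamma> t \<in> fst c"
    using assms(1) unfolding smooth_atlas_def by blast
  then have c: "c \<in> A \<and> \<gamma> t \<in> fst c" unfolding c_def by (rule someI_ex)
  have "g c (\<gamma> t) v v \<ge> 0" for v
  proof (cases "v = 0")
    case True
    then show ?thesis using assms(2) c unfolding riemannian_metric_def
      by (metis bilinear_lzero order_refl)
  next
    case False
    then show ?thesis using assms(2) c unfolding riemannian_metric_def
      by (meson less_imp_le)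
  qed
  then show ?thesis unfolding speed_def Let_def c_def by simp
qed

text \<open>A real \<open>Inf\<close> is a lower bound only for a set that is bounded below, which
  here rests on the nonnegativity of the speed. A speed that is not integrable has length 0 by
  convention, so 0 bounds that case as well.\<close>

lemma riemannian_distance_le:
  assumes "smooth_atlas A" "riemannian_metric A g"
    and "piecewise_C1_curve A \<gamma>" "\<gamma> 0 = x" "\<gamma> 1 = y"
  shows "riemannian_distance A g x y \<le> curve_length A g \<gamma>"
  unfolding riemannian_distance_def
proof (rule cInf_lower)
  show "bdd_below {curve_length A g \<gamma> |\<gamma>. piecewise_C1_curve A \<gamma> \<and> \<gamma> 0 = x \<and> \<gamma> 1 = y}"
  proof (rule bdd_belowI[of _ 0])
    fix l assume "l \<in> {curve_length A g \<gamma> |\<gamma>. piecewise_C1_curve A \<gamma> \<and> \<gamma> 0 = x \<and> \<gamma> 1 = y}"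
    then obtain \<gamma> where "l = curve_length A g \<gamma>" by blast
    then show "0 \<le> l" unfolding curve_length_def
      by (cases "speed A g \<gamma> integrable_on {0..1}")
        (auto intro!: integral_nonneg speed_nonneg[OF assms(1,2)] simp: not_integrable_integral)
  qed
qed (use assms in blast)

text \<open>The crude sum of matrix entries is used because each entry is continuous in the
  coordinates by the smoothness of the metric, so the whole bound is continuous and attains a finite
  maximum on compact sets.\<close>

lemma bilinear_diag_le:
  fixes b :: "'e::euclidean_space \<Rightarrow> 'e \<Rightarrow> real"
  assumes "bilinear b"
  shows "b w w \<le> (\<Sum>i\<in>Basis. \<Sum>j\<in>Basis. \<bar>b i j\<bar>) * (norm w)\<^sup>2"
proof -
  have "b w w = b (\<Sum>i\<in>Basis. (w \<bullet> i) *\<^sub>R i) (\<Sum>j\<in>Basis. (w \<bullet> j) *\<^sub>R j)"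
    by (simp add: euclidean_representation)
  also have "\<dots> = (\<Sum>i\<in>Basis. \<Sum>j\<in>Basis. (w \<bullet> i) * (w \<bullet> j) * b i j)"
    unfolding bilinear_sum[OF assms]
    by (simp add: sum.cartesian_product case_prod_beta bilinear_lmul[OF assms]
        bilinear_rmul[OF assms] ac_simps)
  also have "\<dots> \<le> (\<Sum>i\<in>Basis. \<Sum>j\<in>Basis. \<bar>b i j\<bar> * (norm w)\<^sup>2)"
  proof (intro sum_mono)
    fix i j :: 'e assume ij: "i \<in> Basis" "j \<in> Basis"
    have "(w \<bullet> i) * (w \<bullet> j) * b i j \<le> \<bar>w \<bullet> i\<bar> * \<bar>w \<bullet> j\<bar> * \<bar>b i j\<bar>"
      by (metis abs_ge_self abs_mult)
    also have "\<dots> \<le> norm w * norm w * \<bar>b i j\<bar>"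
      using ij by (intro mult_mono Basis_le_norm mult_right_mono) auto
    finally show "(w \<bullet> i) * (w \<bullet> j) * b i j \<le> \<bar>b i j\<bar> * (norm w)\<^sup>2"
      by (simp add: power2_eq_square algebra_simps)
  qed
  finally show ?thesis by (simp add: sum_distrib_right)
qed

lemma riemannian_metric_locally_bounded:
  assumes g: "riemannian_metric A g" and c: "c \<in> A"
    and S: "compact S" "S \<subseteq> snd c ` fst c" and inv: "\<And>p. p \<in> S \<Longrightarrow> chart_inv c p \<in> fst c"
  obtains B where "B \<ge> 0" "\<And>p w. p \<in> S \<Longrightarrow> g c (chart_inv c p) w w \<le> B * (norm w)\<^sup>2"
proof -
  let ?h = "\<lambda>p. \<Sum>i\<in>Basis. \<Sum>j\<in>Basis. \<bar>g c (chart_inv c p) i j\<bar>"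
  have "continuous_on (snd c ` fst c) (\<lambda>p. g c (chart_inv c p) v w)" for v w
  proof -
    have "C_k_on 0 (\<lambda>p. g c (chart_inv c p) v w) (snd c ` fst c)"
      using g c unfolding riemannian_metric_def smooth_on_def by blast
    then show ?thesis by simp
  qed
  then have "continuous_on S ?h"
    by (intro continuous_intros) (meson S(2) continuous_on_subset)
  then have "bounded (?h ` S)"
    using S(1) compact_continuous_image compact_imp_bounded by blast
  then obtain B where B: "B > 0" "\<And>p. p \<in> S \<Longrightarrow> norm (?h p) \<le> B"
    by (auto simp: bounded_pos)
  show ?thesis
  proof (rule that[of B])
    fix p w assume p: "p \<in> S"
    have "bilinear (g c (chart_inv c p))"
      using g c inv[OF p] unfolding riemannian_metric_def by blast
    then have "g c (chart_inv c p) w w \<le> ?h p * (norm w)\<^sup>2" by (rule bilinear_diag_le)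
    also have "\<dots> \<le> B * (norm w)\<^sup>2"
      using B(2)[OF p] by (intro mult_right_mono) auto
    finally show "g c (chart_inv c p) w w \<le> B * (norm w)\<^sup>2" .
  qed (use B in simp)
qed

text \<open>The comparison curve is the coordinate segment.\<close>

lemma dist_le_coordinate_dist:
  fixes A :: "('a::{metric_space, second_countable_topology}, 'e::euclidean_space) chart set"
  assumes mfd: "riemannian_manifold A g" and c: "c \<in> A"
    and S: "convex S" "S \<subseteq> snd c ` fst c"
    and B: "B \<ge> 0" "\<And>p w. p \<in> S \<Longrightarrow> g c (chart_inv c p) w w \<le> B * (norm w)\<^sup>2"
    and x: "x \<in> fst c" "snd c x \<in> S" and y: "y \<in> fst c" "snd c y \<in> S"
  shows "dist x y \<le> sqrt B * norm (snd c y - snd c x)"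
proof -
  have A: "smooth_atlas A" and g: "riemannian_metric A g"
    and d: "\<And>x y. dist x y = riemannian_distance A g x y"
    using mfd unfolding riemannian_manifold_def by auto
  have hom: "homeomorphism (fst c) (snd c ` fst c) (snd c) (chart_inv c)"
    using A c by (simp add: smooth_atlas_def)
  define w where "w = snd c y - snd c x"
  define line where "line t = snd c x + t *\<^sub>R w" for t :: real
  define \<gamma> where "\<gamma> t = chart_inv c (line t)" for t
  have lineS: "line t \<in> S" if "t \<in> {0..1}" for t
  proof -
    have "line t = (1 - t) *\<^sub>R snd c x + t *\<^sub>R snd c y"
      unfolding line_def w_def by (simp add: algebra_simps)
    then show ?thesis using S(1) x(2) y(2) that by (auto simp: convex_alt)
  qed
  have inv: "chart_inv c p \<in> fst c" "snd c (chart_inv c p) = p" if "p \<in> S" for p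
  proof -
    have p: "p \<in> snd c ` fst c" using S(2) that by (rule subsetD)
    show "chart_inv c p \<in> fst c"
      using p homeomorphism_image2[OF hom] by (metis imageI)
    show "snd c (chart_inv c p) = p"
      using p homeomorphism_apply2[OF hom] by metis
  qed
  have \<gamma>c: "\<gamma> t \<in> fst c" "snd c (\<gamma> t) = line t" if "t \<in> {0..1}" for t
    using inv[OF lineS[OF that]] by (simp_all add: \<gamma>_def)
  have \<gamma>0: "\<gamma> 0 = x" and \<gamma>1: "\<gamma> 1 = y"
    using hom x y unfolding \<gamma>_def line_def w_def homeomorphism_def by auto
  have line_cont: "continuous_on U line" for U
    unfolding line_def by (intro continuous_intros)
  have \<gamma>_cont: "continuous_on {0..1} \<gamma>"
    unfolding \<gamma>_def
    by (rule continuous_on_compose2[OF homeomorphism_cont2[OF hom] line_cont])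
      (use lineS S(2) in auto)
  \<comment> \<open>The velocity of \<open>\<gamma>\<close> read in the chart \<open>c'\<close>: the
    chain rule for the transition map along the segment with constant velocity
    \<open>w\<close>.\<close>
  define D where "D c' t = frechet_derivative (transition c c') (at (line t)) w" for c' t
  have in_dom: "line t \<in> snd c ` (fst c \<inter> fst c')" if "t \<in> {0..1}" "\<gamma> t \<in> fst c'" for c' t
    using \<gamma>c[OF that(1)] that(2) by (metis IntI image_eqI)
  have smooth: "smooth_on (transition c c') (snd c ` (fst c \<inter> fst c'))" if "c' \<in> A" for c'
    using A c that unfolding smooth_atlas_def by blast
  have deriv: "((snd c' \<circ> \<gamma>) has_vector_derivative D c' t) (at t within {0..1})"
    if "c' \<in> A" "t \<in> {0..1}" "\<gamma> t \<in> fst c'" for c' t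
  proof -
    have "C_k_on (Suc 0) (transition c c') (snd c ` (fst c \<inter> fst c'))"
      using smooth[OF that(1)] unfolding smooth_on_def by blast
    then have "transition c c' differentiable (at (line t))"
      using in_dom[OF that(2,3)] unfolding C_k_on.simps by blast
    then have "(transition c c' has_derivative frechet_derivative (transition c c') (at (line t)))
        (at (line t))"
      by (simp add: frechet_derivative_works)
    moreover have "(line has_vector_derivative w) (at t within {0..1})"
      unfolding line_def by (auto intro!: derivative_eq_intros)
    ultimately have "((transition c c' \<circ> line) has_vector_derivative D c' t) (at t within {0..1})"
      unfolding D_def
      by (metis has_derivative_at_withinI vector_derivative_diff_chain_within)
    moreover have "transition c c' \<circ> line = snd c' \<circ> \<gamma>"
      unfolding transition_def \<gamma>_def by auto
    ultimately show ?thesis by simp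
  qed
  have "C1_curve A 0 1 \<gamma>"
    unfolding C1_curve_def
  proof (intro conjI ballI exI)
    fix c' assume c': "c' \<in> A"
    have "C_k_on (Suc 0) (transition c c') (snd c ` (fst c \<inter> fst c'))"
      using smooth[OF c'] unfolding smooth_on_def by blast
    then have "continuous_on (snd c ` (fst c \<inter> fst c'))
        (\<lambda>p. frechet_derivative (transition c c') (at p) w)"
      by simp
    then show "continuous_on {t \<in> {0..1}. \<gamma> t \<in> fst c'} (D c')"
      unfolding D_def
      by (rule continuous_on_compose2[OF _ line_cont]) (use in_dom in auto)
  qed (use \<gamma>_cont deriv in auto)
  then have pw: "piecewise_C1_curve A \<gamma>"
    unfolding piecewise_C1_curve_def
    by (intro exI[of _ 1] exI[of _ "real"]) auto
  \<comment> \<open>The chart inside \<open>speed\<close> is an arbitrary choice; the transformation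
    law of the metric carries the computation back to \<open>c\<close>, where the velocity is
    \<open>w\<close>.\<close>
  have speed: "speed A g \<gamma> t = sqrt (g c (\<gamma> t) w w)" if t: "t \<in> {0..1}" for t
  proof -
    define c' where "c' = (SOME c. c \<in> A \<and> \<gamma> t \<in> fst c)"
    have "c \<in> A \<and> \<gamma> t \<in> fst c" using c \<gamma>c t by blast
    then have c': "c' \<in> A \<and> \<gamma> t \<in> fst c'" unfolding c'_def by (rule someI)
    have "vector_derivative (snd c' \<circ> \<gamma>) (at t within {0..1}) = D c' t"
      using deriv c' t by (intro vector_derivative_within_closed_interval) auto
    then have "speed A g \<gamma> t = sqrt (g c' (\<gamma> t) (D c' t) (D c' t))"
      unfolding speed_def Let_def c'_def by simp
    moreover have "g c (\<gamma> t) w w = g c' (\<gamma> t) (D c' t) (D c' t)"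
    proof -
      have "\<forall>c\<in>A. \<forall>c'\<in>A. \<forall>x\<in>fst c \<inter> fst c'. \<forall>v w.
          g c x v w = g c' x (frechet_derivative (transition c c') (at (snd c x)) v)
            (frechet_derivative (transition c c') (at (snd c x)) w)"
        using g unfolding riemannian_metric_def by (elim conjE)
      then have "g c (\<gamma> t) w w =
          g c' (\<gamma> t) (frechet_derivative (transition c c') (at (snd c (\<gamma> t))) w)
            (frechet_derivative (transition c c') (at (snd c (\<gamma> t))) w)"
        using c c' \<gamma>c(1)[OF t] by blast
      then show ?thesis unfolding D_def \<gamma>c(2)[OF t] .
    qed
    ultimately show ?thesis by simp
  qed
  have speed_le: "speed A g \<gamma> t \<le> sqrt B * norm w" if t: "t \<in> {0..1}" for t
  proof -
    have "speed A g \<gamma> t \<le> sqrt (B * (norm w)\<^sup>2)"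
      unfolding speed[OF t] using B(2)[OF lineS[OF t]] by (simp add: \<gamma>_def)
    then show ?thesis by (simp add: real_sqrt_mult)
  qed
  have "dist x y \<le> curve_length A g \<gamma>"
    unfolding d using A g pw \<gamma>0 \<gamma>1 by (rule riemannian_distance_le)
  also have "\<dots> \<le> sqrt B * norm w"
  \<comment> \<open>If the speed is not integrable, the length is 0 by convention and the bound is
    trivial.\<close>
  proof (cases "speed A g \<gamma> integrable_on {0..1}")
    case True
    then have "curve_length A g \<gamma> \<le> integral {0..1} (\<lambda>_::real. sqrt B * norm w)"
      unfolding curve_length_def by (intro integral_le speed_le) auto
    then show ?thesis by simp
  next
    case False
    then show ?thesis using B(1) by (simp add: curve_length_def not_integrable_integral)
  qed
  finally show ?thesis unfolding w_def .
qed

section \<open>Sets of finite box dimension\<close>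

text \<open>Finite upper box dimension with explicit constants at every scale. The scale is
  \<open>1 / k\<close> with natural \<open>k\<close>, so that a power of n can be inserted for
  \<open>k\<close>; the exponent \<open>d\<close> is free, so that a union can take the larger
  one.\<close>

definition polynomially_covered :: "'a::metric_space set \<Rightarrow> bool" where
  "polynomially_covered S \<longleftrightarrow>
     (\<exists>a d :: nat. \<exists>B::real. \<forall>k\<ge>1. \<exists>\<U>. finite \<U> \<and> card \<U> \<le> a * k ^ d \<and> S \<subseteq> \<Union>\<U> \<and>
        (\<forall>U\<in>\<U>. \<forall>x\<in>U. \<forall>y\<in>U. dist x y \<le> B / real k))"

lemma polynomially_covered_subset:
  assumes "polynomially_covered S" "R \<subseteq> S"
  shows "polynomially_covered R"
  using assms unfolding polynomially_covered_def by (meson subset_trans)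

lemma polynomially_covered_empty: "polynomially_covered {}"
  unfolding polynomially_covered_def by (intro exI[of _ 0] allI impI exI[of _ "{}"]) auto

lemma polynomially_covered_Un:
  assumes "polynomially_covered S" "polynomially_covered R"
  shows "polynomially_covered (S \<union> R)"
proof -
  obtain a d B where S: "\<And>k. k \<ge> 1 \<Longrightarrow> \<exists>\<U>. finite \<U> \<and> card \<U> \<le> a * k ^ d \<and> S \<subseteq> \<Union>\<U> \<and>
        (\<forall>U\<in>\<U>. \<forall>x\<in>U. \<forall>y\<in>U. dist x y \<le> B / real k)"
    using assms(1) unfolding polynomially_covered_def by blast
  obtain a' d' B' where R: "\<And>k. k \<ge> 1 \<Longrightarrow> \<exists>\<U>. finite \<U> \<and> card \<U> \<le> a' * k ^ d' \<and> R \<subseteq> \<Union>\<U> \<and>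
        (\<forall>U\<in>\<U>. \<forall>x\<in>U. \<forall>y\<in>U. dist x y \<le> B' / real k)"
    using assms(2) unfolding polynomially_covered_def by blast
  show ?thesis unfolding polynomially_covered_def
  proof (rule exI[of _ "a + a'"], rule exI[of _ "max d d'"], rule exI[of _ "max B B'"], intro allI impI)
    fix k :: nat assume k: "k \<ge> 1"
    obtain \<U> where U: "finite \<U>" "card \<U> \<le> a * k ^ d" "S \<subseteq> \<Union>\<U>"
        "\<And>U x y. U \<in> \<U> \<Longrightarrow> x \<in> U \<Longrightarrow> y \<in> U \<Longrightarrow> dist x y \<le> B / real k"
      using S[OF k] by blast
    obtain \<V> where V: "finite \<V>" "card \<V> \<le> a' * k ^ d'" "R \<subseteq> \<Union>\<V>"
        "\<And>U x y. U \<in> \<V> \<Longrightarrow> x \<in> U \<Longrightarrow> y \<in> U \<Longrightarrow> dist x y \<le> B' / real k"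
      using R[OF k] by blast
    have "card (\<U> \<union> \<V>) \<le> a * k ^ d + a' * k ^ d'"
      using card_Un_le U(2) V(2) by (meson add_mono order_trans)
    also have "\<dots> \<le> a * k ^ max d d' + a' * k ^ max d d'"
      using k by (intro add_mono mult_left_mono power_increasing) auto
    finally have "card (\<U> \<union> \<V>) \<le> (a + a') * k ^ max d d'" by (simp add: algebra_simps)
    moreover have "B / real k \<le> max B B' / real k" "B' / real k \<le> max B B' / real k"
      by (auto intro: divide_right_mono)
    then have "\<forall>U\<in>\<U> \<union> \<V>. \<forall>x\<in>U. \<forall>y\<in>U. dist x y \<le> max B B' / real k"
      using U(4) V(4) by (meson UnE order_trans)
    ultimately show "\<exists>\<U>. finite \<U> \<and> card \<U> \<le> (a + a') * k ^ max d d' \<and> S \<union> R \<subseteq> \<Union>\<U> \<and>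
        (\<forall>U\<in>\<U>. \<forall>x\<in>U. \<forall>y\<in>U. dist x y \<le> max B B' / real k)"
      using U V by (intro exI[of _ "\<U> \<union> \<V>"]) auto
  qed
qed

text \<open>Grid cubes of side \<open>1 / k\<close> in the bounded image are pulled back; the
  Lipschitz bound for the inverse of \<open>h\<close> turns their size into a bound on
  distances.\<close>

lemma polynomially_covered_Lipschitz_chart:
  fixes h :: "'a::metric_space \<Rightarrow> 'e::euclidean_space"
  assumes L: "L \<ge> 0" "\<And>x y. x \<in> S \<Longrightarrow> y \<in> S \<Longrightarrow> dist x y \<le> L * norm (h x - h y)"
    and bd: "\<And>x. x \<in> S \<Longrightarrow> norm (h x) \<le> real R"
  shows "polynomially_covered S"
proof -
  have "\<exists>\<U>. finite \<U> \<and> card \<U> \<le> (2 * R + 3) ^ DIM('e) * k ^ DIM('e) \<and> S \<subseteq> \<Union>\<U> \<and>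
        (\<forall>U\<in>\<U>. \<forall>x\<in>U. \<forall>y\<in>U. dist x y \<le> L * real DIM('e) / real k)" if k: "k \<ge> 1" for k :: nat
  proof -
    define cell where "cell x = restrict (\<lambda>i. \<lfloor>(h x \<bullet> i) * real k\<rfloor>) Basis" for x
    \<comment> \<open>The scaled coordinates are at most \<open>R * k\<close> in absolute value;
      with a margin of 1 on each side this leaves \<open>2 * (R * k) + 3\<close> integers per
      coordinate.\<close>
    define box where "box = (Basis :: 'e set) \<rightarrow>\<^sub>E {- int (R * k) - 1 .. int (R * k) + 1}"
    define \<U> where "\<U> = (\<lambda>v. {x \<in> S. cell x = v}) ` box"
    have cell: "cell x \<in> box" if x: "x \<in> S" for x
    proof -
      have "\<lfloor>(h x \<bullet> i) * real k\<rfloor> \<in> {- int (R * k) - 1 .. int (R * k) + 1}" if i: "i \<in> Basis" for i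
      proof -
        have "\<bar>h x \<bullet> i\<bar> \<le> real R" using Basis_le_norm[OF i] bd[OF x] order_trans by blast
        then have "\<bar>(h x \<bullet> i) * real k\<bar> \<le> real (R * k)"
          by (simp add: abs_mult mult_right_mono)
        then show ?thesis
          by (simp add: floor_le_iff le_floor_iff flip: of_nat_mult) linarith
      qed
      then show ?thesis unfolding box_def cell_def by auto
    qed
    have fin: "finite box" unfolding box_def by (intro finite_PiE) auto
    have "card \<U> \<le> card box" unfolding \<U>_def by (rule card_image_le[OF fin])
    also have "card box = (2 * (R * k) + 3) ^ DIM('e)"
      unfolding box_def by (simp add: card_PiE nat_add_distrib nat_mult_distrib add.commute)
    also have "\<dots> \<le> ((2 * R + 3) * k) ^ DIM('e)"
      using k by (intro power_mono) (auto simp: algebra_simps)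
    finally have card: "card \<U> \<le> (2 * R + 3) ^ DIM('e) * k ^ DIM('e)"
      by (simp add: power_mult_distrib)
    have diam: "dist x y \<le> L * real DIM('e) / real k"
      if x: "x \<in> S" and y: "y \<in> S" and eq: "cell x = cell y" for x y
    proof -
      have "\<bar>(h x - h y) \<bullet> i\<bar> \<le> 1 / real k" if i: "i \<in> Basis" for i
      proof -
        have "\<lfloor>(h x \<bullet> i) * real k\<rfloor> = \<lfloor>(h y \<bullet> i) * real k\<rfloor>"
          using fun_cong[OF eq, of i] i by (simp add: cell_def)
        then have "\<bar>(h x \<bullet> i) * real k - (h y \<bullet> i) * real k\<bar> \<le> 1" by linarith
        then have "\<bar>(h x - h y) \<bullet> i\<bar> * real k \<le> 1"
          by (metis abs_mult abs_of_nat inner_diff_left left_diff_distrib)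
        then show ?thesis using k by (simp add: field_simps)
      qed
      then have "(\<Sum>i\<in>Basis. \<bar>(h x - h y) \<bullet> i\<bar>) \<le> (\<Sum>i\<in>(Basis::'e set). 1 / real k)"
        by (rule sum_mono)
      then have "norm (h x - h y) \<le> real DIM('e) / real k"
        using norm_le_l1[of "h x - h y"] by simp
      then show ?thesis using L(2)[OF x y] mult_left_mono[OF _ L(1)] by fastforce
    qed
    show ?thesis
      by (intro exI[of _ \<U>]) (use fin card cell diam in \<open>auto simp: \<U>_def\<close>)
  qed
  then show ?thesis unfolding polynomially_covered_def by blast
qed

text \<open>A closed coordinate ball serves twice: compactness bounds the metric on it, and
  convexity keeps the coordinate segments inside it.\<close>

lemma riemannian_manifold_locally_polynomially_covered:
  fixes A :: "('a::{metric_space, second_countable_topology}, 'e::euclidean_space) chart set"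
  fixes p :: 'a
  assumes mfd: "riemannian_manifold A g"
  obtains U where "open U" "p \<in> U" "polynomially_covered U"
proof -
  have A: "smooth_atlas A" and g: "riemannian_metric A g"
    using mfd unfolding riemannian_manifold_def by auto
  obtain c where c: "c \<in> A" "p \<in> fst c"
    using A unfolding smooth_atlas_def by blast
  have op: "open (fst c)" "open (snd c ` fst c)"
    and hom: "homeomorphism (fst c) (snd c ` fst c) (snd c) (chart_inv c)"
    using A c(1) unfolding smooth_atlas_def by blast+
  obtain r where r: "r > 0" "cball (snd c p) r \<subseteq> snd c ` fst c"
    using op(2) c(2) open_contains_cball by blast
  obtain B where B: "B \<ge> 0"
      "\<And>q w. q \<in> cball (snd c p) r \<Longrightarrow> g c (chart_inv c q) w w \<le> B * (norm w)\<^sup>2"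
  proof (rule riemannian_metric_locally_bounded[OF g c(1) compact_cball r(2)])
    show "chart_inv c q \<in> fst c" if "q \<in> cball (snd c p) r" for q
      using homeomorphism_image2[OF hom] subsetD[OF r(2) that] by (metis imageI)
  qed blast
  define U where "U = fst c \<inter> snd c -` ball (snd c p) r"
  obtain R :: nat where R: "norm (snd c p) + r \<le> real R"
    using real_arch_simple by blast
  show ?thesis
  proof
    show "open U"
      unfolding U_def using continuous_on_open_vimage[OF op(1)] homeomorphism_cont1[OF hom]
      by (metis Int_commute open_ball)
    show "p \<in> U" unfolding U_def using c r by auto
    show "polynomially_covered U"
    proof (rule polynomially_covered_Lipschitz_chart[of "sqrt B" U "snd c" R])
      fix x y assume xy: "x \<in> U" "y \<in> U"
      show "dist x y \<le> sqrt B * norm (snd c x - snd c y)"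
        using dist_le_coordinate_dist[OF mfd c(1) convex_cball r(2) B, of x y] xy
        by (auto simp: U_def norm_minus_commute)
    next
      fix x assume "x \<in> U"
      then have "dist (snd c p) (snd c x) < r" by (simp add: U_def)
      then show "norm (snd c x) \<le> real R"
        using R norm_triangle_ineq2[of "snd c x" "snd c p"] by (simp add: dist_norm norm_minus_commute)
    qed (use B in auto)
  qed
qed

text \<open>By Lindelof countably many small coordinate neighbourhoods suffice, and finite unions
  keep the covering property. The covering constants may deteriorate with \<open>n\<close>; a single
  large \<open>n\<close> will be fixed later.\<close>

lemma riemannian_manifold_exhaustion:
  fixes A :: "('a::{metric_space, second_countable_topology}, 'e::euclidean_space) chart set"
  assumes mfd: "riemannian_manifold A g"
  obtains W :: "nat \<Rightarrow> 'a set"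
  where "\<And>n. open (W n)" "\<And>n. polynomially_covered (W n)" "mono W" "(\<Union>n. W n) = UNIV"
proof -
  define \<F> where "\<F> = {U::'a set. open U \<and> polynomially_covered U}"
  obtain \<F>' where F': "\<F>' \<subseteq> \<F>" "countable \<F>'" "\<Union>\<F>' = \<Union>\<F>"
    using Lindelof[of \<F>] by (auto simp: \<F>_def)
  have "p \<in> \<Union>\<F>" for p
  proof (rule riemannian_manifold_locally_polynomially_covered[OF mfd, of p])
    fix U assume "open U" "p \<in> U" "polynomially_covered U"
    then show "p \<in> \<Union>\<F>" by (auto simp: \<F>_def)
  qed
  then have "\<Union>\<F> = UNIV" by blast
  with F' have un: "\<Union>\<F>' = UNIV" and ne: "\<F>' \<noteq> {}" by auto
  define V where "V = from_nat_into \<F>'"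
  have V: "open (V n)" "polynomially_covered (V n)" for n
    using from_nat_into[OF ne] F'(1) by (auto simp: V_def \<F>_def)
  have rangeV: "(\<Union>n. V n) = UNIV"
    using un range_from_nat_into[OF ne F'(2)] by (simp add: V_def)
  show ?thesis
  proof (rule that[of "\<lambda>n. \<Union>i<n. V i"])
    show "polynomially_covered (\<Union>i<n. V i)" for n
      by (induction n) (auto simp: polynomially_covered_empty lessThan_Suc V
          intro!: polynomially_covered_Un)
    show "mono (\<lambda>n. \<Union>i<n. V i)" by (auto simp: mono_def) (meson lessThan_iff order_less_le_trans)
    show "(\<Union>n. \<Union>i<n. V i) = UNIV" using rangeV by auto
  qed (use V in auto)
qed

text \<open>A Euclidean space has positive dimension, so a chart image is never one point. Two
  distinct points are wanted because on a one-point space the Hoelder seminorm is the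
  \<open>Sup\<close> of the empty set, about which nothing is known.\<close>

lemma riemannian_manifold_not_singleton:
  fixes A :: "('a::{metric_space, second_countable_topology}, 'e::euclidean_space) chart set"
  assumes mfd: "riemannian_manifold A g"
  obtains a b :: 'a where "a \<noteq> b"
proof (rule ccontr)
  assume "\<not> thesis"
  then have eq: "\<And>a b :: 'a. a = b" using that by blast
  have A: "smooth_atlas A" using mfd unfolding riemannian_manifold_def by auto
  obtain c where c: "c \<in> A" "undefined \<in> fst c"
    using A unfolding smooth_atlas_def by blast
  have "fst c = {undefined}" using eq c(2) by blast
  moreover have "open (snd c ` fst c)" using A c(1) unfolding smooth_atlas_def by blast
  ultimately show False by (simp add: not_open_singleton)
qed

section \<open>Decorrelation of products\<close>

lemma sup_norm_unit:
  assumes "\<And>x. norm (f x) \<le> 1"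
  shows "0 \<le> sup_norm f" "sup_norm f \<le> 1"
proof -
  have bdd: "bdd_above (range (\<lambda>x. norm (f x)))" using assms by (intro bdd_aboveI[of _ 1]) auto
  show "0 \<le> sup_norm f" unfolding sup_norm_def
    by (rule cSUP_upper2[OF bdd, of undefined]) auto
  show "sup_norm f \<le> 1" unfolding sup_norm_def using assms by (intro cSUP_least) auto
qed

lemma hoelder_quotients_le:
  assumes "\<And>x y. dist (f x) (f y) \<le> L * dist x y powr \<alpha>" "q \<in> hoelder_quotients \<alpha> f"
  shows "q \<le> L"
  using assms by (auto simp: hoelder_quotients_def divide_le_eq)

lemma hoelderI:
  assumes "\<And>x. norm (f x) \<le> B" "\<And>x y. dist (f x) (f y) \<le> L * dist x y powr \<alpha>"
  shows "hoelder \<alpha> f"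
  unfolding hoelder_def
proof
  show "bdd_above (range (\<lambda>x. norm (f x)))" using assms(1) by (intro bdd_aboveI[of _ B]) auto
  show "bdd_above (hoelder_quotients \<alpha> f)"
    using hoelder_quotients_le[OF assms(2)] by (rule bdd_aboveI)
qed

text \<open>The points \<open>a\<close> and \<open>b\<close> make the set of quotients nonempty,
  without which neither bound on its \<open>Sup\<close> follows.\<close>

lemma hoelder_seminorm_bounds:
  fixes f :: "'a::metric_space \<Rightarrow> 'b::metric_space"
  assumes ab: "a \<noteq> (b::'a)" and "\<And>x y. dist (f x) (f y) \<le> L * dist x y powr \<alpha>"
  shows "0 \<le> hoelder_seminorm \<alpha> f" "hoelder_seminorm \<alpha> f \<le> L"
proof -
  have in_q: "dist (f a) (f b) / dist a b powr \<alpha> \<in> hoelder_quotients \<alpha> f"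
    using ab unfolding hoelder_quotients_def by blast
  have le: "q \<le> L" if "q \<in> hoelder_quotients \<alpha> f" for q
    using hoelder_quotients_le[OF assms(2) that] .
  then show "hoelder_seminorm \<alpha> f \<le> L"
    unfolding hoelder_seminorm_def using in_q by (intro cSup_least) auto
  have "0 \<le> dist (f a) (f b) / dist a b powr \<alpha>" by simp
  also have "\<dots> \<le> hoelder_seminorm \<alpha> f"
    unfolding hoelder_seminorm_def using in_q le by (intro cSup_upper bdd_aboveI[of _ L])
  finally show "0 \<le> hoelder_seminorm \<alpha> f" .
qed

text \<open>(MD) at one exponent, in the form in which it is applied: factors bounded by 1, any
  valid Hoelder constants in place of the seminorms, past and future families indexed from 0, and
  absolute times \<open>k j\<close> that already contain the gap. The clause
  \<open>N \<le> k j\<close> keeps \<open>k j - N\<close> meaningful even for an empty past.\<close>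

definition decorrelates ::
  "'a::metric_space measure \<Rightarrow> ('a \<Rightarrow> 'a) \<Rightarrow> real \<Rightarrow> real \<Rightarrow> real \<Rightarrow> bool" where
  "decorrelates M T \<alpha> C \<delta> \<longleftrightarrow>
     (\<forall>(m::nat) (m'::nat) (u :: nat \<Rightarrow> 'a \<Rightarrow> complex) (v :: nat \<Rightarrow> 'a \<Rightarrow> complex) L L' l k (N::nat).
        (\<forall>i<m. \<forall>x. cmod (u i x) \<le> 1) \<longrightarrow> (\<forall>j<m'. \<forall>x. cmod (v j x) \<le> 1) \<longrightarrow>
        (\<forall>i<m. \<forall>x y. dist (u i x) (u i y) \<le> L i * dist x y powr \<alpha>) \<longrightarrow>
        (\<forall>j<m'. \<forall>x y. dist (v j x) (v j y) \<le> L' j * dist x y powr \<alpha>) \<longrightarrow>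
        mono_on {..<m} l \<longrightarrow> mono_on {..<m'} k \<longrightarrow>
        (\<forall>j<m'. N \<le> k j \<and> (\<forall>i<m. l i + N \<le> k j)) \<longrightarrow> N > 0 \<longrightarrow>
        cmod (Cov M (\<lambda>x. \<Prod>i<m. u i ((T ^^ l i) x)) (\<lambda>x. \<Prod>j<m'. v j ((T ^^ k j) x)))
          \<le> C * (1 + (\<Sum>i<m. L i) + (\<Sum>j<m'. L' j)) * \<delta> ^ N)"

lemma decorrelatesD:
  fixes m m' :: nat
  assumes "decorrelates M T \<alpha> C \<delta>"
    and "\<And>i x. i < m \<Longrightarrow> cmod (u i x) \<le> 1" "\<And>j x. j < m' \<Longrightarrow> cmod (v j x) \<le> 1"
    and "\<And>i x y. i < m \<Longrightarrow> dist (u i x) (u i y) \<le> L i * dist x y powr \<alpha>"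
    and "\<And>j x y. j < m' \<Longrightarrow> dist (v j x) (v j y) \<le> L' j * dist x y powr \<alpha>"
    and "mono_on {..<m} l" "mono_on {..<m'} k"
    and "\<And>j. j < m' \<Longrightarrow> N \<le> k j" "\<And>i j. i < m \<Longrightarrow> j < m' \<Longrightarrow> l i + N \<le> k j" "N > 0"
  shows "cmod (Cov M (\<lambda>x. \<Prod>i<m. u i ((T ^^ l i) x)) (\<lambda>x. \<Prod>j<m'. v j ((T ^^ k j) x)))
          \<le> C * (1 + (\<Sum>i<m. L i) + (\<Sum>j<m'. L' j)) * \<delta> ^ N"
  by (rule assms(1)[unfolded decorrelates_def, rule_format])
    (use assms(2-) in auto)

lemma sum_lessThan_add:
  fixes h :: "nat \<Rightarrow> 'b::comm_monoid_add"
  shows "(\<Sum>i<m + n. h i) = (\<Sum>i<m. h i) + (\<Sum>i<n. h (m + i))"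
  by (induction n) (auto simp: add.assoc)

lemma multiple_decorrelation_decorrelates:
  fixes M :: "'a::metric_space measure"
  assumes md: "multiple_decorrelation M T" and \<alpha>: "\<alpha> > 0" and ab: "a \<noteq> (b::'a)"
  obtains C \<delta> where "C > 0" "0 < \<delta>" "\<delta> < 1" "decorrelates M T \<alpha> C \<delta>"
proof -
  obtain C \<delta> where C: "C > 0" and \<delta>: "\<delta> \<in> {0<..<1}" and
    md': "\<forall>(m::nat) (m'::nat) (\<phi> :: nat \<Rightarrow> 'a \<Rightarrow> complex) (l :: nat \<Rightarrow> nat) (k :: nat \<Rightarrow> nat) (N::nat).
          (\<forall>i\<in>{1..m+m'}. hoelder \<alpha> (\<phi> i)) \<longrightarrow>
          mono_on {1..m} l \<longrightarrow> mono_on {1..m'} k \<longrightarrow>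
          (\<forall>i\<in>{1..m}. \<forall>j\<in>{1..m'}. l i \<le> k j) \<longrightarrow> N > 0 \<longrightarrow>
          cmod (Cov M (\<lambda>x. \<Prod>i=1..m. \<phi> i ((T ^^ l i) x))
                      (\<lambda>x. \<Prod>j=1..m'. \<phi> (m + j) ((T ^^ (k j + N)) x)))
            \<le> C * ((\<Prod>i=1..m+m'. sup_norm (\<phi> i)) +
                   (\<Sum>j=1..m+m'. hoelder_seminorm \<alpha> (\<phi> j) *
                      (\<Prod>i\<in>{1..m+m'} - {j}. sup_norm (\<phi> i)))) * \<delta> ^ N"
    using md[unfolded multiple_decorrelation_def, rule_format, OF \<alpha>] by blast
  have "decorrelates M T \<alpha> C \<delta>"
    unfolding decorrelates_def
  proof (intro allI impI)
    fix m m' :: nat and u v :: "nat \<Rightarrow> 'a \<Rightarrow> complex" and L L' l k and N :: nat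
    assume u: "\<forall>i<m. \<forall>x. cmod (u i x) \<le> 1" and v: "\<forall>j<m'. \<forall>x. cmod (v j x) \<le> 1"
      and Lu: "\<forall>i<m. \<forall>x y. dist (u i x) (u i y) \<le> L i * dist x y powr \<alpha>"
      and Lv: "\<forall>j<m'. \<forall>x y. dist (v j x) (v j y) \<le> L' j * dist x y powr \<alpha>"
      and mono: "mono_on {..<m} l" "mono_on {..<m'} k"
      and gap: "\<forall>j<m'. N \<le> k j \<and> (\<forall>i<m. l i + N \<le> k j)" and N: "N > 0"
    define \<phi> where "\<phi> i = (if i \<le> m then u (i - 1) else v (i - m - 1))" for i
    define K where "K i = (if i \<le> m then L (i - 1) else L' (i - m - 1))" for i
    define l' where "l' i = l (i - 1)" for i
    define k' where "k' j = k (j - 1) - N" for j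
    have unit: "cmod (\<phi> i x) \<le> 1" if "i \<in> {1..m + m'}" for i x
      using u v that by (auto simp: \<phi>_def)
    have lip: "dist (\<phi> i x) (\<phi> i y) \<le> K i * dist x y powr \<alpha>" if "i \<in> {1..m + m'}" for i x y
    proof (cases "i \<le> m")
      case True
      then show ?thesis using Lu that by (auto simp: \<phi>_def K_def)
    next
      case False
      then have "i - m - 1 < m'" using that by auto
      then show ?thesis using Lv False by (auto simp: \<phi>_def K_def)
    qed
    have sup: "0 \<le> sup_norm (\<phi> i)" "sup_norm (\<phi> i) \<le> 1" if "i \<in> {1..m + m'}" for i
      using sup_norm_unit[of "\<phi> i"] unit[OF that] by auto
    have semi: "0 \<le> hoelder_seminorm \<alpha> (\<phi> i)" "hoelder_seminorm \<alpha> (\<phi> i) \<le> K i"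
      if "i \<in> {1..m + m'}" for i
      using hoelder_seminorm_bounds[OF ab lip[OF that]] by auto
    have "mono_on {1..m} l'"
      unfolding l'_def by (intro mono_onI mono_onD[OF mono(1)]) auto
    moreover have "mono_on {1..m'} k'"
      unfolding k'_def by (intro mono_onI diff_le_mono mono_onD[OF mono(2)]) auto
    moreover have "l' i \<le> k' j" if "i \<in> {1..m}" "j \<in> {1..m'}" for i j
    proof -
      have "l (i - 1) + N \<le> k (j - 1)" using gap that by auto
      then show ?thesis by (simp add: l'_def k'_def)
    qed
    moreover have "hoelder \<alpha> (\<phi> i)" if "i \<in> {1..m + m'}" for i
      using unit[OF that] lip[OF that] by (rule hoelderI)
    ultimately have bound: "cmod (Cov M (\<lambda>x. \<Prod>i=1..m. \<phi> i ((T ^^ l' i) x))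
                      (\<lambda>x. \<Prod>j=1..m'. \<phi> (m + j) ((T ^^ (k' j + N)) x)))
            \<le> C * ((\<Prod>i=1..m+m'. sup_norm (\<phi> i)) +
                   (\<Sum>j=1..m+m'. hoelder_seminorm \<alpha> (\<phi> j) *
                      (\<Prod>i\<in>{1..m+m'} - {j}. sup_norm (\<phi> i)))) * \<delta> ^ N"
      using md'[rule_format, of m m' \<phi> l' k' N] N by blast
    have past: "(\<Prod>i=1..m. \<phi> i ((T ^^ l' i) x)) = (\<Prod>i<m. u i ((T ^^ l i) x))" for x
      by (simp add: prod.atLeast1_atMost_eq \<phi>_def l'_def Suc_le_eq)
    have future: "(\<Prod>j=1..m'. \<phi> (m + j) ((T ^^ (k' j + N)) x)) = (\<Prod>j<m'. v j ((T ^^ k j) x))" for x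
      unfolding One_nat_def prod.atLeast1_atMost_eq by (intro prod.cong) (use gap in \<open>auto simp: \<phi>_def k'_def\<close>)
    have "(\<Prod>i=1..m+m'. sup_norm (\<phi> i)) \<le> 1"
      using sup by (intro prod_le_1) auto
    moreover have "(\<Sum>j=1..m+m'. hoelder_seminorm \<alpha> (\<phi> j) *
        (\<Prod>i\<in>{1..m+m'} - {j}. sup_norm (\<phi> i))) \<le> (\<Sum>j=1..m+m'. K j)"
    proof (rule sum_mono)
      fix j assume j: "j \<in> {1..m+m'}"
      have "(\<Prod>i\<in>{1..m+m'} - {j}. sup_norm (\<phi> i)) \<le> 1" "0 \<le> (\<Prod>i\<in>{1..m+m'} - {j}. sup_norm (\<phi> i))"
        using sup by (auto intro!: prod_le_1 prod_nonneg)
      then show "hoelder_seminorm \<alpha> (\<phi> j) * (\<Prod>i\<in>{1..m+m'} - {j}. sup_norm (\<phi> i)) \<le> K j"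
        using semi[OF j] by (metis mult.right_neutral mult_left_mono order_trans)
    qed
    moreover have "(\<Sum>j=1..m+m'. K j) = (\<Sum>i<m. L i) + (\<Sum>j<m'. L' j)"
      unfolding One_nat_def sum.atLeast1_atMost_eq sum_lessThan_add
      by (simp add: K_def Suc_le_eq)
    ultimately have "C * ((\<Prod>i=1..m+m'. sup_norm (\<phi> i)) +
                   (\<Sum>j=1..m+m'. hoelder_seminorm \<alpha> (\<phi> j) *
                      (\<Prod>i\<in>{1..m+m'} - {j}. sup_norm (\<phi> i)))) * \<delta> ^ N
        \<le> C * (1 + (\<Sum>i<m. L i) + (\<Sum>j<m'. L' j)) * \<delta> ^ N"
      using C \<delta> by (intro mult_right_mono mult_left_mono) auto
    with bound show "cmod (Cov M (\<lambda>x. \<Prod>i<m. u i ((T ^^ l i) x)) (\<lambda>x. \<Prod>j<m'. v j ((T ^^ k j) x)))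
          \<le> C * (1 + (\<Sum>i<m. L i) + (\<Sum>j<m'. L' j)) * \<delta> ^ N"
      unfolding past future by (rule order_trans)
  qed
  with C \<delta> show ?thesis by (intro that) auto
qed

section \<open>The central limit theorem for a fixed observable\<close>

lemma cmod_iexp_diff_le: "cmod (iexp a - iexp b) \<le> \<bar>a - b\<bar>"
proof -
  have "iexp a - iexp b = iexp b * (iexp (a - b) - 1)"
    by (simp add: algebra_simps flip: exp_add)
  then have "cmod (iexp a - iexp b) = cmod (iexp (a - b) - 1)"
    by (simp add: norm_mult)
  also have "\<dots> \<le> \<bar>a - b\<bar>" using iexp_approx1[of "a - b" 0] by simp
  finally show ?thesis .
qed

lemma iexp_increment_expansion:
  fixes s a R R1 S0 g :: real
  assumes a: "\<bar>a\<bar> \<le> 1" and R: "\<bar>R\<bar> \<le> g" and R1: "\<bar>R1\<bar> \<le> g" and g: "g \<ge> 1"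
  shows "cmod (iexp (s * (S0 + R1 + R + a)) - iexp (s * (S0 + R1 + R))
      - (\<i> * s * (iexp (s * (S0 + R1)) * a) - s\<^sup>2 * (iexp (s * S0) * (R * a))
         - s\<^sup>2 / 2 * (iexp (s * S0) * (a * a)))) \<le> 3 * \<bar>s\<bar> ^ 3 * g\<^sup>2"
proof -
  define X A B D where "X = iexp (s * S0)" "A = iexp (s * R1)" "B = iexp (s * R)" "D = iexp (s * a)"
  have unit: "cmod X = 1" "cmod A = 1" "cmod B = 1" "cmod D = 1"
    unfolding X_A_B_D_def by simp_all
  have prods: "iexp (s * (S0 + R1 + R + a)) = X * A * B * D" "iexp (s * (S0 + R1 + R)) = X * A * B"
      "iexp (s * (S0 + R1)) = X * A" "iexp (s * S0) = X"
    unfolding X_A_B_D_def by (simp_all add: distrib_left flip: exp_add)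
  \<comment> \<open>The four summands are the Taylor remainder in \<open>a\<close>, the Taylor
    remainder in \<open>R\<close> of the linear term, the removal of \<open>R1\<close> from the
    mixed term, and the removal of both gaps from the square term. Each is of third order in
    \<open>s\<close>.\<close>
  have "iexp (s * (S0 + R1 + R + a)) - iexp (s * (S0 + R1 + R))
      - (\<i> * s * (iexp (s * (S0 + R1)) * a) - s\<^sup>2 * (iexp (s * S0) * (R * a))
         - s\<^sup>2 / 2 * (iexp (s * S0) * (a * a)))
    = X * (A * B * (D - (1 + \<i> * (s * a) - (s * a)\<^sup>2 / 2)) + \<i> * (s * a) * A * (B - (1 + \<i> * (s * R)))
        + (A - 1) * (\<i> * (s * a)) * (\<i> * (s * R)) - (s * a)\<^sup>2 / 2 * (A * B - 1))" (is "?lhs = X * (?a + ?b + ?c - ?d)")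
    unfolding prods by (simp add: field_simps power2_eq_square)
  also have "cmod \<dots> = cmod (?a + ?b + ?c - ?d)"
    by (simp add: norm_mult unit)
  also have "\<dots> \<le> cmod ?a + cmod ?b + cmod ?c + cmod ?d"
    by (meson norm_triangle_ineq norm_triangle_ineq4 add_right_mono order_trans)
  finally have tri: "cmod ?lhs \<le> cmod ?a + cmod ?b + cmod ?c + cmod ?d" .
  have sa: "\<bar>s * a\<bar> \<le> \<bar>s\<bar>" using a by (simp add: abs_mult mult_left_le)
  have sR: "\<bar>s * R\<bar> \<le> \<bar>s\<bar> * g" using R by (simp add: abs_mult mult_left_mono)
  have sR1: "\<bar>s * R1\<bar> \<le> \<bar>s\<bar> * g" using R1 by (simp add: abs_mult mult_left_mono)
  have a_le: "cmod ?a \<le> \<bar>s\<bar> ^ 3 / 6"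
  proof -
    have "cmod ?a = cmod (D - (1 + \<i> * (s * a) - (s * a)\<^sup>2 / 2))"
      by (simp add: norm_mult unit)
    also have "\<dots> \<le> \<bar>s * a\<bar> ^ 3 / 6"
      using iexp_approx1[of "s * a" 2]
      by (simp add: X_A_B_D_def eval_nat_numeral power2_eq_square algebra_simps)
    also have "\<dots> \<le> \<bar>s\<bar> ^ 3 / 6" using power_mono[OF sa, of 3] by simp
    finally show ?thesis .
  qed
  have b_le: "cmod ?b \<le> \<bar>s\<bar> * ((\<bar>s\<bar> * g)\<^sup>2 / 2)"
  proof -
    have "cmod ?b = \<bar>s * a\<bar> * cmod (B - (1 + \<i> * (s * R)))"
      by (simp add: norm_mult unit abs_mult)
    also have "cmod (B - (1 + \<i> * (s * R))) \<le> \<bar>s * R\<bar>\<^sup>2 / 2"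
      using iexp_approx1[of "s * R" 1]
      by (simp add: X_A_B_D_def eval_nat_numeral power2_eq_square algebra_simps)
    also have "\<dots> \<le> (\<bar>s\<bar> * g)\<^sup>2 / 2" using power_mono[OF sR, of 2] by simp
    finally show ?thesis using sa by (meson abs_ge_zero mult_left_mono mult_mono norm_ge_zero order_trans zero_le_power2 divide_nonneg_nonneg zero_le_numeral mult_right_mono)
  qed
  have c_le: "cmod ?c \<le> (\<bar>s\<bar> * g) * \<bar>s\<bar> * (\<bar>s\<bar> * g)"
  proof -
    have "cmod (A - 1) \<le> \<bar>s\<bar> * g"
      using cmod_iexp_diff_le[of "s * R1" 0] sR1 by (simp add: X_A_B_D_def)
    moreover have "cmod ?c = cmod (A - 1) * \<bar>s * a\<bar> * \<bar>s * R\<bar>"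
      by (simp add: norm_mult abs_mult)
    ultimately show ?thesis using sa sR g by (simp add: mult_mono)
  qed
  have d_le: "cmod ?d \<le> \<bar>s\<bar>\<^sup>2 / 2 * (2 * (\<bar>s\<bar> * g))"
  proof -
    have "A * B = iexp (s * R1 + s * R)"
      unfolding X_A_B_D_def by (simp add: distrib_left exp_add)
    then have "cmod (A * B - 1) \<le> \<bar>s * R1 + s * R\<bar>"
      using cmod_iexp_diff_le[of "s * R1 + s * R" 0] by simp
    also have "\<dots> \<le> 2 * (\<bar>s\<bar> * g)" using sR sR1 by linarith
    finally have "cmod (A * B - 1) \<le> 2 * (\<bar>s\<bar> * g)" .
    moreover have "cmod ?d = \<bar>s * a\<bar>\<^sup>2 / 2 * cmod (A * B - 1)"
      by (simp add: norm_mult norm_divide norm_power power_mult_distrib)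
    moreover have "\<bar>s * a\<bar>\<^sup>2 / 2 \<le> \<bar>s\<bar>\<^sup>2 / 2" using power_mono[OF sa, of 2] by simp
    ultimately show ?thesis by (simp only:) (intro mult_mono; simp)
  qed
  have "cmod ?lhs \<le> \<bar>s\<bar> ^ 3 / 6 + \<bar>s\<bar> * ((\<bar>s\<bar> * g)\<^sup>2 / 2) + (\<bar>s\<bar> * g) * \<bar>s\<bar> * (\<bar>s\<bar> * g)
      + \<bar>s\<bar>\<^sup>2 / 2 * (2 * (\<bar>s\<bar> * g))"
    using tri a_le b_le c_le d_le by linarith
  also have "\<dots> = \<bar>s\<bar> ^ 3 * (1 / 6 + g\<^sup>2 / 2 + g\<^sup>2 + g)"
    by (simp add: power2_eq_square power3_eq_cube algebra_simps)
  also have "\<dots> \<le> \<bar>s\<bar> ^ 3 * (3 * g\<^sup>2)"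
  proof (intro mult_left_mono)
    have "g \<le> g\<^sup>2" "1 \<le> g\<^sup>2" using g one_le_power[OF g, of 2] by (simp_all add: power2_eq_square mult_le_cancel_left1)
    then show "1 / 6 + g\<^sup>2 / 2 + g\<^sup>2 + g \<le> 3 * g\<^sup>2" by linarith
  qed simp
  finally show ?thesis by (simp add: mult_ac)
qed

text \<open>A discrete Gronwall bound. Since \<open>Q \<ge> 1\<close>, every power of
  \<open>q\<close> that multiplies an earlier error is at most \<open>Q ^ r\<close>.\<close>

lemma approximate_geometric:
  fixes z :: "nat \<Rightarrow> complex" and q :: complex
  assumes q: "cmod q \<le> Q" and Q: "Q \<ge> 1" and e: "e \<ge> 0"
    and step: "\<And>i. i < r \<Longrightarrow> cmod (z (Suc (m + i)) - q * z (m + i)) \<le> e"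
  shows "cmod (z (m + r) - q ^ r * z m) \<le> real r * Q ^ r * e"
  using step
proof (induction r)
  case (Suc r)
  have "z (m + Suc r) - q ^ Suc r * z m
      = (z (Suc (m + r)) - q * z (m + r)) + q * (z (m + r) - q ^ r * z m)"
    by (simp add: algebra_simps)
  then have "cmod (z (m + Suc r) - q ^ Suc r * z m)
      \<le> cmod (z (Suc (m + r)) - q * z (m + r)) + cmod q * cmod (z (m + r) - q ^ r * z m)"
    by (metis norm_mult norm_triangle_ineq)
  also have "\<dots> \<le> e + Q * (real r * Q ^ r * e)"
    using Suc q Q by (intro add_mono mult_mono) auto
  also have "\<dots> \<le> Q ^ Suc r * e + Q * (real r * Q ^ r * e)"
    using mult_right_mono[OF one_le_power[OF Q, of "Suc r"] e] by simp
  also have "\<dots> = real (Suc r) * Q ^ Suc r * e" by (simp add: algebra_simps)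
  finally show ?case .
qed simp


section \<open>Integration along a measure preserving map\<close>

locale pmp_dynamics =
  fixes M :: "'a::{metric_space, second_countable_topology} measure" and T :: "'a \<Rightarrow> 'a"
  assumes pmp: "pmp_system M T"
begin

sublocale prob_space M using pmp by (simp add: pmp_system_def)

lemma T_pow_measurable [measurable]: "(T ^^ k) \<in> measurable M M"
  by (induction k) (use pmp in \<open>auto simp: pmp_system_def\<close>)

lemma distr_T_pow: "distr M M (T ^^ k) = M"
proof (induction k)
  case 0
  then show ?case by (simp add: distr_id)
next
  case (Suc k)
  have "distr M M (T ^^ Suc k) = distr (distr M M (T ^^ k)) M T"
    using pmp by (subst distr_distr) (auto simp: pmp_system_def)
  then show ?case using Suc pmp by (simp add: pmp_system_def o_def)
qed

lemma integral_T_pow: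
  fixes h :: "'a \<Rightarrow> 'b::{banach, second_countable_topology}"
  assumes "h \<in> borel_measurable M"
  shows "(LINT x|M. h ((T ^^ k) x)) = (LINT x|M. h x)"
  by (metis assms distr_T_pow integral_distr T_pow_measurable)

lemma integrable_bounded:
  fixes h :: "'a \<Rightarrow> 'b::{banach, second_countable_topology}"
  assumes "h \<in> borel_measurable M" "\<And>x. norm (h x) \<le> B"
  shows "integrable M h"
  using assms by (intro integrable_const_bound[of _ B]) auto

text \<open>No measurability is involved: the integral of a function that is not integrable is 0,
  which is why \<open>B\<close> has to be nonnegative.\<close>

lemma integral_norm_le:
  fixes h :: "'a \<Rightarrow> 'b::{banach, second_countable_topology}"
  assumes "\<And>x. norm (h x) \<le> B" "B \<ge> 0"
  shows "norm (LINT x|M. h x) \<le> B"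
proof (cases "integrable M h")
  case True
  have "norm (LINT x|M. h x) \<le> (LINT x|M. norm (h x))" by (rule integral_norm_bound)
  also have "\<dots> \<le> (LINT x|M. B)" using True assms by (intro integral_mono) auto
  finally show ?thesis by (simp add: prob_space)
next
  case False
  then show ?thesis using assms by (simp add: not_integrable_integral_eq)
qed

lemma continuous_borel_measurable:
  fixes h :: "'a \<Rightarrow> 'b::topological_space"
  assumes "continuous_on UNIV h"
  shows "h \<in> borel_measurable M"
proof -
  have "h \<in> borel_measurable borel" using assms by (rule borel_measurable_continuous_onI)
  then show ?thesis
    using pmp unfolding pmp_system_def measurable_def by auto
qed

end

text \<open>The observable is normalised so that both \<open>f\<close> and its exponentials are
  admissible factors for \<open>decorrelates\<close>; the scale is restored at the end by rescaling
  \<open>t\<close>.\<close>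

locale decorrelated_observable = pmp_dynamics +
  fixes f :: "'a \<Rightarrow> real" and \<alpha> L C \<delta> :: real
  assumes decorrelates: "decorrelates M T \<alpha> C \<delta>"
    and C_pos: "C > 0" and \<delta>_pos: "0 < \<delta>" and \<delta>_less_1: "\<delta> < 1"
    and f_le_1: "\<And>x. \<bar>f x\<bar> \<le> 1"
    and L_nonneg: "L \<ge> 0"
    and f_hoelder: "\<And>x y. \<bar>f x - f y\<bar> \<le> L * dist x y powr \<alpha>"
    and f_borel [measurable]: "f \<in> borel_measurable M"
    and f_centered: "(LINT x|M. f x) = 0"
begin

definition S :: "nat \<Rightarrow> 'a \<Rightarrow> real" where "S n x = (\<Sum>k<n. f ((T ^^ k) x))"

definition char :: "real \<Rightarrow> nat \<Rightarrow> complex" where "char s n = (LINT x|M. iexp (s * S n x))"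

definition corr :: "nat \<Rightarrow> real" where "corr j = (LINT x|M. f x * f ((T ^^ j) x))"

text \<open>The partial sum of the asymptotic variance up to lag \<open>g\<close>: these are the
  correlations that one time step sees inside the last gap.\<close>

definition var_upto :: "nat \<Rightarrow> real" where "var_upto g = corr 0 + 2 * (\<Sum>j=1..g. corr j)"

lemma S_measurable [measurable]: "S n \<in> borel_measurable M"
  unfolding S_def[abs_def] by measurable

lemma cmod_iexp_mult_le_1: "cmod (iexp a * complex_of_real (f x * f y)) \<le> 1"
  unfolding norm_mult norm_of_real abs_mult using f_le_1 by (simp add: mult_le_one)

lemma abs_S_diff_le: "\<bar>S (r + g) x - S r x\<bar> \<le> real g"
proof -
  have "S (r + g) x - S r x = (\<Sum>i<g. f ((T ^^ (r + i)) x))"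
    unfolding S_def sum_lessThan_add by simp
  also have "\<bar>\<dots>\<bar> \<le> (\<Sum>i<g. 1)" by (rule order_trans[OF sum_abs]) (intro sum_mono f_le_1)
  finally show ?thesis by simp
qed

lemma iexp_S_eq_prod: "iexp (s * S n x) = (\<Prod>i<n. iexp (s * f ((T ^^ i) x)))"
  by (simp add: S_def sum_distrib_left exp_sum)

lemma iexp_hoelder: "dist (iexp (s * f x)) (iexp (s * f y)) \<le> (\<bar>s\<bar> * L) * dist x y powr \<alpha>"
proof -
  have "dist (iexp (s * f x)) (iexp (s * f y)) \<le> \<bar>s * f x - s * f y\<bar>"
    unfolding dist_norm by (rule cmod_iexp_diff_le)
  also have "\<dots> = \<bar>s\<bar> * \<bar>f x - f y\<bar>" by (metis abs_mult right_diff_distrib)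
  also have "\<dots> \<le> \<bar>s\<bar> * (L * dist x y powr \<alpha>)" by (intro mult_left_mono f_hoelder) auto
  finally show ?thesis by (simp add: mult_ac)
qed

text \<open>The decorrelation bound for at most \<open>n\<close> exponential factors, of constant
  \<open>\<bar>s\<bar> * L\<close> each, and at most two factors \<open>f\<close>.\<close>

definition decay :: "real \<Rightarrow> nat \<Rightarrow> nat \<Rightarrow> real" where
  "decay s n g = C * (1 + real n * \<bar>s\<bar> * L + 2 * L) * \<delta> ^ g"

lemma decay_nonneg: "decay s n g \<ge> 0"
  unfolding decay_def using C_pos L_nonneg \<delta>_pos by simp

lemma decay_mono: "r \<le> n \<Longrightarrow> decay s r g \<le> decay s n g"
  unfolding decay_def using C_pos L_nonneg \<delta>_pos
  by (intro mult_right_mono mult_left_mono add_mono) auto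

text \<open>Since \<open>f\<close> is centered, the product of the means vanishes and the covariance
  is the integral itself.\<close>

lemma char_decorrelate_one:
  assumes "R + g \<le> m" "g > 0"
  shows "cmod (LINT x|M. iexp (s * S R x) * f ((T ^^ m) x)) \<le> decay s R g"
proof -
  have "cmod (Cov M (\<lambda>x. \<Prod>i<R. iexp (s * f ((T ^^ i) x))) (\<lambda>x. \<Prod>j<(1::nat). complex_of_real (f ((T ^^ m) x))))
      \<le> C * (1 + (\<Sum>i<R. \<bar>s\<bar> * L) + (\<Sum>j<(1::nat). L)) * \<delta> ^ g"
    by (rule decorrelatesD[OF decorrelates, where l = "\<lambda>i. i" and k = "\<lambda>j. m"
        and u = "\<lambda>i x. iexp (s * f x)" and v = "\<lambda>j x. complex_of_real (f x)"])
      (use assms f_le_1 f_hoelder iexp_hoelder in \<open>auto simp: dist_norm mono_on_def simp flip: of_real_diff\<close>)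
  also have "\<dots> \<le> decay s R g"
    unfolding decay_def using C_pos L_nonneg \<delta>_pos by (intro mult_right_mono mult_left_mono) auto
  also have "Cov M (\<lambda>x. \<Prod>i<R. iexp (s * f ((T ^^ i) x))) (\<lambda>x. \<Prod>j<(1::nat). complex_of_real (f ((T ^^ m) x)))
      = (LINT x|M. iexp (s * S R x) * f ((T ^^ m) x))"
    unfolding Cov_def iexp_S_eq_prod
    using integral_T_pow[of f m] by (simp add: f_centered)
  finally show ?thesis .
qed

lemma char_decorrelate_two:
  assumes "R + g \<le> a" "g > 0"
  shows "cmod ((LINT x|M. iexp (s * S R x) * (f ((T ^^ a) x) * f ((T ^^ (a + j)) x))) - corr j * char s R)
    \<le> decay s R g"
proof -
  \<comment> \<open>The two future times; for \<open>j = 0\<close> they coincide, which gives the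
    square of the observable.\<close>
  let ?k = "\<lambda>i. if i = 0 then a else a + j"
  have "cmod (Cov M (\<lambda>x. \<Prod>i<R. iexp (s * f ((T ^^ i) x))) (\<lambda>x. \<Prod>i<(2::nat). complex_of_real (f ((T ^^ ?k i) x))))
      \<le> C * (1 + (\<Sum>i<R. \<bar>s\<bar> * L) + (\<Sum>i<(2::nat). L)) * \<delta> ^ g"
    by (rule decorrelatesD[OF decorrelates, where l = "\<lambda>i. i" and k = ?k
        and u = "\<lambda>i x. iexp (s * f x)" and v = "\<lambda>j x. complex_of_real (f x)"])
      (use assms f_le_1 f_hoelder iexp_hoelder in \<open>auto simp: dist_norm mono_on_def simp flip: of_real_diff\<close>)
  also have "\<dots> = decay s R g" unfolding decay_def by simp
  also have "Cov M (\<lambda>x. \<Prod>i<R. iexp (s * f ((T ^^ i) x))) (\<lambda>x. \<Prod>i<(2::nat). complex_of_real (f ((T ^^ ?k i) x)))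
      = (LINT x|M. iexp (s * S R x) * (f ((T ^^ a) x) * f ((T ^^ (a + j)) x))) - corr j * char s R"
  proof -
    have "(LINT x|M. f ((T ^^ a) x) * f ((T ^^ (a + j)) x)) = corr j"
    proof -
      have "(T ^^ (a + j)) x = (T ^^ j) ((T ^^ a) x)" for x
        by (metis add.commute comp_apply funpow_add)
      then show ?thesis
        unfolding corr_def using integral_T_pow[of "\<lambda>x. f x * f ((T ^^ j) x)" a] by simp
    qed
    then have "(LINT x|M. complex_of_real (f ((T ^^ a) x)) * f ((T ^^ (a + j)) x)) = corr j"
      by (metis (mono_tags, lifting) Bochner_Integration.integral_cong integral_complex_of_real of_real_mult)
    then show ?thesis
      unfolding Cov_def char_def iexp_S_eq_prod by (simp add: numeral_2_eq_2 mult.commute)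
  qed
  finally show ?thesis .
qed

lemma abs_corr_le_1: "\<bar>corr j\<bar> \<le> 1"
  unfolding corr_def real_norm_def[symmetric]
  by (rule integral_norm_le) (auto simp: abs_mult intro: mult_le_one f_le_1)

lemma abs_corr_le: "j > 0 \<Longrightarrow> \<bar>corr j\<bar> \<le> C * (1 + 2 * L) * \<delta> ^ j"
proof -
  assume j: "j > 0"
  have "cmod (Cov M (\<lambda>x. \<Prod>i<(1::nat). complex_of_real (f ((T ^^ 0) x))) (\<lambda>x. \<Prod>i<(1::nat). complex_of_real (f ((T ^^ j) x))))
      \<le> C * (1 + (\<Sum>i<(1::nat). L) + (\<Sum>i<(1::nat). L)) * \<delta> ^ j"
    by (rule decorrelatesD[OF decorrelates, where l = "\<lambda>i. 0" and k = "\<lambda>i. j"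
        and u = "\<lambda>i x. complex_of_real (f x)" and v = "\<lambda>i x. complex_of_real (f x)"])
      (use j f_le_1 f_hoelder in \<open>auto simp: dist_norm mono_on_def simp flip: of_real_diff\<close>)
  also have "Cov M (\<lambda>x. \<Prod>i<(1::nat). complex_of_real (f ((T ^^ 0) x))) (\<lambda>x. \<Prod>i<(1::nat). complex_of_real (f ((T ^^ j) x)))
     = complex_of_real (corr j)"
    unfolding Cov_def corr_def by (simp add: f_centered flip: of_real_mult)
  finally show ?thesis by (simp add: algebra_simps)
qed

lemma summable_corr: "summable (\<lambda>k. corr (Suc k))"
proof (rule summable_comparison_test')
  show "summable (\<lambda>k. C * (1 + 2 * L) * \<delta> * \<delta> ^ k)"
    using \<delta>_pos \<delta>_less_1 by (intro summable_mult summable_geometric) auto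
  show "norm (corr (Suc k)) \<le> C * (1 + 2 * L) * \<delta> * \<delta> ^ k" for k
    using abs_corr_le[of "Suc k"] by (simp add: mult_ac)
qed

lemma asymptotic_variance_eq: "asymptotic_variance M T f = corr 0 + 2 * (\<Sum>k. corr (Suc k))"
  unfolding asymptotic_variance_def corr_def by (simp add: power2_eq_square)

lemma asymptotic_variance_scale:
  "asymptotic_variance M T (\<lambda>x. c * f x) = c\<^sup>2 * asymptotic_variance M T f"
proof -
  have "(LINT x|M. (c * f x) * (c * f ((T ^^ k) x))) = c\<^sup>2 * corr k" for k
    unfolding corr_def by (subst integral_mult_right_zero[symmetric])
      (simp add: power2_eq_square mult_ac)
  note eq = this
  have "asymptotic_variance M T (\<lambda>x. c * f x) = c\<^sup>2 * corr 0 + 2 * (\<Sum>k. c\<^sup>2 * corr (Suc k))"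
    unfolding asymptotic_variance_def eq using eq[of 0] by (simp add: power2_eq_square)
  also have "(\<Sum>k. c\<^sup>2 * corr (Suc k)) = c\<^sup>2 * (\<Sum>k. corr (Suc k))"
    using summable_corr by (rule suminf_mult)
  finally show ?thesis unfolding asymptotic_variance_eq by (simp add: algebra_simps)
qed

lemma var_upto_tendsto: "var_upto \<longlonglongrightarrow> asymptotic_variance M T f"
proof -
  have "(\<lambda>g. corr 0 + 2 * (\<Sum>k<g. corr (Suc k))) \<longlonglongrightarrow> corr 0 + 2 * (\<Sum>k. corr (Suc k))"
    by (intro tendsto_intros summable_LIMSEQ summable_corr)
  then show ?thesis
    unfolding asymptotic_variance_eq by (simp add: var_upto_def[abs_def] sum.atLeast1_atMost_eq)
qed

lemma abs_var_upto_le: "\<bar>var_upto g\<bar> \<le> 1 + 2 * real g"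
proof -
  have "\<bar>\<Sum>j=1..g. corr j\<bar> \<le> (\<Sum>j=1..g. 1)"
    by (rule order_trans[OF sum_abs]) (intro sum_mono abs_corr_le_1)
  then show ?thesis unfolding var_upto_def using abs_corr_le_1[of 0] by simp
qed

lemma char_diff_le: "cmod (char s (r + g) - char s r) \<le> \<bar>s\<bar> * real g"
proof -
  have "char s (r + g) - char s r = (LINT x|M. iexp (s * S (r + g) x) - iexp (s * S r x))"
    unfolding char_def
    by (intro Bochner_Integration.integral_diff[symmetric] integrable_bounded[of _ 1]) auto
  also have "cmod \<dots> \<le> \<bar>s\<bar> * real g"
  proof (rule integral_norm_le)
    fix x
    have "cmod (iexp (s * S (r + g) x) - iexp (s * S r x)) \<le> \<bar>s * S (r + g) x - s * S r x\<bar>"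
      by (rule cmod_iexp_diff_le)
    also have "\<dots> = \<bar>s\<bar> * \<bar>S (r + g) x - S r x\<bar>" by (metis abs_mult right_diff_distrib)
    also have "\<dots> \<le> \<bar>s\<bar> * real g" by (intro mult_left_mono abs_S_diff_le) auto
    finally show "cmod (iexp (s * S (r + g) x) - iexp (s * S r x)) \<le> \<bar>s\<bar> * real g" .
  qed auto
  finally show ?thesis .
qed

text \<open>
  The increment of the characteristic function over one time step is decorrelated from the past
  after two gaps of length \<open>g\<close>: the first one isolates \<open>f \<circ> T ^^ m\<close>, the second one isolates its
  correlations with the \<open>g\<close> observations before it.
\<close>

lemma char_step:
  assumes g: "g > 0" and m: "2 * g \<le> m"
  shows "cmod (char s (Suc m) - (1 - s\<^sup>2 / 2 * var_upto g) * char s m)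
    \<le> 6 * \<bar>s\<bar> ^ 3 * (real g)\<^sup>2 + (\<bar>s\<bar> + s\<^sup>2 * (real g + 1)) * decay s m g"
proof -
  \<comment> \<open>The past is cut at \<open>r\<close> and \<open>r + g\<close>. In the terms of
    \<open>iexp_increment_expansion\<close>, \<open>S r\<close> is the distant past,
    \<open>S (r + g) x - S r x\<close> is the first gap \<open>R1\<close>, and \<open>R\<close>
    below is the second.\<close>
  define r where "r = m - 2 * g"
  have m_eq: "m = r + g + g" using m by (simp add: r_def)
  define R where "R x = S m x - S (r + g) x" for x
  have R_sum: "R x = (\<Sum>i<g. f ((T ^^ (r + g + i)) x))" for x
    unfolding R_def m_eq S_def sum_lessThan_add by simp
  have [measurable]: "R \<in> borel_measurable M" unfolding R_def[abs_def] by measurable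
  have R_le: "\<bar>R x\<bar> \<le> real g" for x unfolding R_def m_eq by (rule abs_S_diff_le)
  let ?f = "\<lambda>x. f ((T ^^ m) x)"
  let ?A = "\<lambda>x. iexp (s * S (r + g) x) * ?f x"
  let ?B = "\<lambda>x. iexp (s * S r x) * (R x * ?f x)"
  let ?D = "\<lambda>x. iexp (s * S r x) * (?f x * ?f x)"
  let ?E = "\<lambda>x. \<i> * s * ?A x - s\<^sup>2 * ?B x - s\<^sup>2 / 2 * ?D x"
  have intA: "integrable M ?A"
    by (rule integrable_bounded[of _ 1]) (auto simp: norm_mult f_le_1)
  have intB: "integrable M ?B"
  proof (rule integrable_bounded[of _ "real g"])
    show "cmod (?B x) \<le> real g" for x
      using mult_mono[OF R_le[of x] f_le_1[of "(T ^^ m) x"]] by (simp add: norm_mult)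
  qed auto
  have intD: "integrable M ?D"
    by (rule integrable_bounded[of _ 1]) (measurable, rule cmod_iexp_mult_le_1)
  have intS: "integrable M (\<lambda>x. iexp (s * S k x))" for k
    by (rule integrable_bounded[of _ 1]) auto
  have "char s (Suc m) - char s m - (LINT x|M. ?E x)
      = (LINT x|M. iexp (s * S (Suc m) x) - iexp (s * S m x) - ?E x)"
    unfolding char_def using intA intB intD intS by simp
  also have "cmod \<dots> \<le> 3 * \<bar>s\<bar> ^ 3 * (real g)\<^sup>2"
  proof (rule integral_norm_le)
    fix x
    have "\<bar>S (r + g) x - S r x\<bar> \<le> real g" by (rule abs_S_diff_le)
    moreover have "S (Suc m) x = S r x + (S (r + g) x - S r x) + R x + ?f x"
      "S m x = S r x + (S (r + g) x - S r x) + R x"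
      "S (r + g) x = S r x + (S (r + g) x - S r x)"
      unfolding R_def by (simp_all add: S_def)
    ultimately show "cmod (iexp (s * S (Suc m) x) - iexp (s * S m x) - ?E x) \<le> 3 * \<bar>s\<bar> ^ 3 * (real g)\<^sup>2"
      using iexp_increment_expansion[of "?f x" "R x" "real g" "S (r + g) x - S r x" s "S r x"]
        f_le_1 R_le[of x] g by simp
  qed auto
  finally have main: "cmod (char s (Suc m) - char s m - (LINT x|M. ?E x)) \<le> 3 * \<bar>s\<bar> ^ 3 * (real g)\<^sup>2" .
  have E: "(LINT x|M. ?E x) = \<i> * s * (LINT x|M. ?A x) - s\<^sup>2 * (LINT x|M. ?B x) - s\<^sup>2 / 2 * (LINT x|M. ?D x)"
    using intA intB intD by simp
  have decay_le: "decay s k g \<le> decay s m g" if "k \<le> m" for k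
    using that by (rule decay_mono)
  have A: "cmod (LINT x|M. ?A x) \<le> decay s m g"
    using char_decorrelate_one[of "r + g" g m s] g decay_le[of "r + g"] m_eq by auto
  have D: "cmod ((LINT x|M. ?D x) - corr 0 * char s r) \<le> decay s m g"
    using char_decorrelate_two[of r g m s 0] g decay_le[of r] m_eq by auto
  \<comment> \<open>The terms of \<open>R\<close> sit at times \<open>r + g + i\<close>, that is, at
    lag \<open>g - i\<close> before \<open>m\<close>. Each of them, paired with the new term, is
    separated from \<open>S r\<close> by the first gap, so that its correlation splits off.\<close>
  have B: "cmod ((LINT x|M. ?B x) - (\<Sum>j=1..g. corr j) * char s r) \<le> real g * decay s m g"
  proof -
    let ?b = "\<lambda>i x. iexp (s * S r x) * (f ((T ^^ (r + g + i)) x) * ?f x)"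
    have int: "integrable M (?b i)" for i
      by (rule integrable_bounded[of _ 1]) (measurable, rule cmod_iexp_mult_le_1)
    have "(LINT x|M. ?B x) = (LINT x|M. (\<Sum>i<g. ?b i x))"
      unfolding R_sum by (simp add: sum_distrib_left sum_distrib_right)
    also have "\<dots> = (\<Sum>i<g. LINT x|M. ?b i x)"
      using int by (intro Bochner_Integration.integral_sum) auto
    finally have B_sum: "(LINT x|M. ?B x) = (\<Sum>i<g. LINT x|M. ?b i x)" .
    have "(\<Sum>j=1..g. corr j) = (\<Sum>i<g. corr (g - i))"
      unfolding One_nat_def sum.atLeast1_atMost_eq
      by (rule sum.reindex_bij_witness[of _ "\<lambda>i. g - Suc i" "\<lambda>i. g - Suc i"]) auto
    then have "(LINT x|M. ?B x) - (\<Sum>j=1..g. corr j) * char s r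
        = (\<Sum>i<g. (LINT x|M. ?b i x) - corr (g - i) * char s r)"
      unfolding B_sum by (simp only: sum_subtractf sum_distrib_right of_real_sum)
    also have "cmod \<dots> \<le> (\<Sum>i<g. decay s m g)"
    proof (rule order_trans[OF norm_sum], rule sum_mono)
      fix i assume "i \<in> {..<g}"
      then have m': "r + g + i + (g - i) = m" by (simp add: m_eq)
      have "cmod ((LINT x|M. ?b i x) - corr (g - i) * char s r) \<le> decay s r g"
        by (rule char_decorrelate_two[of r g "r + g + i" s "g - i", unfolded m']) (use g in auto)
      also have "\<dots> \<le> decay s m g" by (rule decay_le) (simp add: m_eq)
      finally show "cmod ((LINT x|M. ?b i x) - corr (g - i) * char s r) \<le> decay s m g" .
    qed
    finally show ?thesis by simp
  qed
  define EA EB ED where "EA = (LINT x|M. ?A x)"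
    and "EB = (LINT x|M. ?B x)" and "ED = (LINT x|M. ?D x)"
  define V where "V = (\<Sum>j=1..g. corr j)"
  \<comment> \<open>\<open>w\<close> is the Taylor error, \<open>x\<close> the linear term,
    \<open>y\<close> and \<open>z\<close> are the decorrelation errors of the quadratic terms, and
    \<open>u\<close> is the price of replacing \<open>char s r\<close> by
    \<open>char s m\<close>.\<close>
  define w x y z u where
    "w = char s (Suc m) - char s m - (\<i> * s * EA - s\<^sup>2 * EB - s\<^sup>2 / 2 * ED)"
    and "x = \<i> * s * EA"
    and "y = s\<^sup>2 * (EB - V * char s r)"
    and "z = s\<^sup>2 / 2 * (ED - corr 0 * char s r)"
    and "u = s\<^sup>2 / 2 * var_upto g * (char s m - char s r)"
  have split: "char s (Suc m) - (1 - s\<^sup>2 / 2 * var_upto g) * char s m = w + x - y - z + u"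
    unfolding w_def x_def y_def z_def u_def var_upto_def V_def[symmetric] by (simp add: field_simps)
  have "cmod (w + x - y - z + u) \<le> cmod w + cmod x + cmod y + cmod z + cmod u"
    by (intro order_trans[OF norm_triangle_ineq] order_trans[OF norm_triangle_ineq4] add_mono order_refl)
  moreover have "cmod w \<le> 3 * \<bar>s\<bar> ^ 3 * (real g)\<^sup>2"
    using main unfolding E w_def EA_def EB_def ED_def .
  moreover have "cmod x \<le> \<bar>s\<bar> * decay s m g"
    using A unfolding x_def EA_def[symmetric] by (simp add: norm_mult mult_left_mono)
  moreover have "cmod y \<le> s\<^sup>2 * (real g * decay s m g)"
    using B unfolding y_def EB_def[symmetric] V_def[symmetric] norm_mult
    by (simp add: norm_power mult_left_mono)
  moreover have "cmod z \<le> s\<^sup>2 / 2 * decay s m g"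
    using D unfolding z_def ED_def[symmetric] norm_mult norm_of_real
    by (simp add: mult_left_mono)
  \<comment> \<open>The variance contributes \<open>1 + 2 * g\<close> and the distance from
    \<open>r\<close> to \<open>m\<close> contributes \<open>2 * g\<close>; halved, the product is at
    most \<open>3 * g\<^sup>2\<close>. With the 3 from the expansion this makes the 6 of the
    statement.\<close>
  moreover have "cmod u \<le> 3 * \<bar>s\<bar> ^ 3 * (real g)\<^sup>2"
  proof -
    have "cmod (char s m - char s r) \<le> \<bar>s\<bar> * real (2 * g)"
    proof -
      have "r + 2 * g = m" by (simp add: m_eq)
      then show ?thesis using char_diff_le[of s r "2 * g"] by (simp only:)
    qed
    then have "s\<^sup>2 / 2 * \<bar>var_upto g\<bar> * cmod (char s m - char s r)
        \<le> s\<^sup>2 / 2 * (1 + 2 * real g) * (\<bar>s\<bar> * real (2 * g))"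
      by (intro mult_mono abs_var_upto_le mult_left_mono) auto
    moreover have "cmod u = s\<^sup>2 / 2 * \<bar>var_upto g\<bar> * cmod (char s m - char s r)"
      unfolding u_def norm_mult norm_of_real by (simp add: abs_mult)
    moreover have "s\<^sup>2 / 2 * (1 + 2 * real g) * (\<bar>s\<bar> * real (2 * g)) = \<bar>s\<bar> ^ 3 * (real g * (1 + 2 * real g))"
    proof -
      have "s\<^sup>2 = \<bar>s\<bar> * \<bar>s\<bar>" by (simp add: power2_eq_square)
      then show ?thesis by (simp add: power3_eq_cube)
    qed
    moreover have "\<bar>s\<bar> ^ 3 * (real g * (1 + 2 * real g)) \<le> \<bar>s\<bar> ^ 3 * (real g * (3 * real g))"
      using g by (intro mult_left_mono) auto
    moreover have "\<bar>s\<bar> ^ 3 * (real g * (3 * real g)) = 3 * \<bar>s\<bar> ^ 3 * (real g)\<^sup>2"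
      by (simp add: power2_eq_square)
    ultimately show ?thesis by linarith
  qed
  moreover have "6 * \<bar>s\<bar> ^ 3 * (real g)\<^sup>2 + (\<bar>s\<bar> + s\<^sup>2 * (real g + 1)) * decay s m g
      = 3 * \<bar>s\<bar> ^ 3 * (real g)\<^sup>2 + \<bar>s\<bar> * decay s m g + s\<^sup>2 * (real g * decay s m g)
        + s\<^sup>2 / 2 * decay s m g + 3 * \<bar>s\<bar> ^ 3 * (real g)\<^sup>2 + s\<^sup>2 / 2 * decay s m g"
    by (simp add: field_simps)
  moreover have "0 \<le> s\<^sup>2 / 2 * decay s m g" using decay_nonneg by simp
  ultimately show ?thesis unfolding split by linarith
qed

lemma norm_char_le: "cmod (char s n) \<le> 1"
  unfolding char_def by (rule integral_norm_le) auto

text \<open>To the error of \<open>char_step\<close> are added the truncation of the variance at lag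
  \<open>g\<close> and the passage from \<open>1 - s\<^sup>2 / 2 * v\<close> to the exponential,
  whose powers are exact.\<close>

definition step_error :: "real \<Rightarrow> nat \<Rightarrow> nat \<Rightarrow> real" where
  "step_error s n g = 6 * \<bar>s\<bar> ^ 3 * (real g)\<^sup>2 + (\<bar>s\<bar> + s\<^sup>2 * (real g + 1)) * decay s n g
     + s\<^sup>2 / 2 * \<bar>asymptotic_variance M T f - var_upto g\<bar>
     + exp (s\<^sup>2 / 2 * \<bar>asymptotic_variance M T f\<bar>) * (s\<^sup>2 / 2 * asymptotic_variance M T f)\<^sup>2"

lemma step_error_nonneg: "step_error s n g \<ge> 0"
  unfolding step_error_def using decay_nonneg by simp

lemma char_step_asymptotic:
  assumes g: "g > 0" and m: "2 * g \<le> m" "m \<le> n"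
  shows "cmod (char s (Suc m) - exp (- (s\<^sup>2 / 2 * asymptotic_variance M T f)) * char s m) \<le> step_error s n g"
proof -
  define v where "v = asymptotic_variance M T f"
  define q where "q = exp (- (s\<^sup>2 / 2 * v))"
  have "\<bar>q - (1 - s\<^sup>2 / 2 * v)\<bar> \<le> exp (s\<^sup>2 / 2 * \<bar>v\<bar>) * (s\<^sup>2 / 2 * v)\<^sup>2"
  proof -
    define a where "a = s\<^sup>2 / 2 * v"
    have "s\<^sup>2 / 2 * \<bar>v\<bar> = \<bar>a\<bar>" unfolding a_def by (simp add: abs_mult)
    then show ?thesis
      using Taylor_exp_field[of "- a" 1] unfolding q_def a_def[symmetric] by (simp add: power2_eq_square)
  qed
  moreover have "\<bar>(1 - s\<^sup>2 / 2 * v) - (1 - s\<^sup>2 / 2 * var_upto g)\<bar> = s\<^sup>2 / 2 * \<bar>v - var_upto g\<bar>"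
  proof -
    have "(1 - s\<^sup>2 / 2 * v) - (1 - s\<^sup>2 / 2 * var_upto g) = - (s\<^sup>2 / 2 * (v - var_upto g))"
      by (simp add: field_simps)
    then show ?thesis by (simp only: abs_minus_cancel abs_mult) simp
  qed
  ultimately have q: "\<bar>(1 - s\<^sup>2 / 2 * var_upto g) - q\<bar>
      \<le> s\<^sup>2 / 2 * \<bar>v - var_upto g\<bar> + exp (s\<^sup>2 / 2 * \<bar>v\<bar>) * (s\<^sup>2 / 2 * v)\<^sup>2" (is "_ \<le> ?e")
    by linarith
  define w where "w = char s (Suc m) - (1 - s\<^sup>2 / 2 * var_upto g) * char s m"
  define d where "d = (1 - s\<^sup>2 / 2 * var_upto g) - q"
  have split: "char s (Suc m) - q * char s m = w + d * char s m"
    unfolding w_def d_def by (simp add: algebra_simps)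
  have "cmod (w + d * char s m) \<le> cmod w + \<bar>d\<bar> * cmod (char s m)"
    by (rule order_trans[OF norm_triangle_ineq]) (simp add: norm_mult)
  moreover have "\<bar>d\<bar> * cmod (char s m) \<le> \<bar>d\<bar> * 1"
    by (intro mult_left_mono norm_char_le) auto
  moreover have "\<bar>d\<bar> \<le> ?e" using q unfolding d_def .
  moreover have "cmod w \<le> 6 * \<bar>s\<bar> ^ 3 * (real g)\<^sup>2 + (\<bar>s\<bar> + s\<^sup>2 * (real g + 1)) * decay s m g"
    unfolding w_def by (rule char_step[OF g m(1)])
  moreover have "(\<bar>s\<bar> + s\<^sup>2 * (real g + 1)) * decay s m g \<le> (\<bar>s\<bar> + s\<^sup>2 * (real g + 1)) * decay s n g"
    by (intro mult_left_mono decay_mono m) auto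
  ultimately have "cmod (char s (Suc m) - q * char s m) \<le> step_error s n g"
    unfolding step_error_def v_def[symmetric] split by linarith
  then show ?thesis unfolding q_def v_def .
qed

text \<open>The recursion starts at time \<open>2 * g\<close>, the first with room for two gaps; the
  sum before it changes the exponential by at most \<open>\<bar>s\<bar> * real (2 * g)\<close>.
  Taking |v| in \<open>Q\<close> gives \<open>Q \<ge> 1\<close> for either sign of \<open>v\<close>,
  and \<open>Q ^ n\<close> stays bounded when \<open>s\<close> is \<open>t / sqrt n\<close>.\<close>

lemma char_estimate:
  fixes s :: real
  defines "v \<equiv> asymptotic_variance M T f"
  assumes g: "g > 0" and n: "2 * g \<le> n"
  shows "cmod (char s n - exp (- (real (n - 2 * g) * (s\<^sup>2 / 2 * v))))
    \<le> exp (real n * (s\<^sup>2 / 2 * \<bar>v\<bar>)) * (real n * step_error s n g + \<bar>s\<bar> * real (2 * g))"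
proof -
  define r where "r = n - 2 * g"
  have n_eq: "n = 2 * g + r" using n by (simp add: r_def)
  define q where "q = exp (- (s\<^sup>2 / 2 * v))"
  define Q where "Q = exp (s\<^sup>2 / 2 * \<bar>v\<bar>)"
  have Q: "Q \<ge> 1" unfolding Q_def by simp
  have "- (s\<^sup>2 / 2 * v) \<le> \<bar>s\<^sup>2 / 2 * v\<bar>" by linarith
  then have "- (s\<^sup>2 / 2 * v) \<le> s\<^sup>2 / 2 * \<bar>v\<bar>" by (simp add: abs_mult)
  then have qQ: "q \<le> Q" unfolding q_def Q_def by simp
  have q0: "q \<ge> 0" unfolding q_def by simp
  have QrQn: "Q ^ r \<le> Q ^ n" unfolding n_eq using Q by (intro power_increasing) auto
  have "cmod (char s (2 * g + r) - complex_of_real q ^ r * char s (2 * g))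
      \<le> real r * Q ^ r * step_error s n g"
  proof (rule approximate_geometric)
    show "cmod (char s (Suc (2 * g + i)) - complex_of_real q * char s (2 * g + i)) \<le> step_error s n g"
      if "i < r" for i
      using char_step_asymptotic[OF g, of "2 * g + i" n s] that by (simp add: n_eq q_def v_def)
  qed (use q0 qQ Q step_error_nonneg in auto)
  also have "\<dots> \<le> real n * Q ^ n * step_error s n g"
    using QrQn step_error_nonneg Q by (intro mult_right_mono mult_mono) (auto simp: n_eq)
  finally have 1: "cmod (char s n - complex_of_real q ^ r * char s (2 * g)) \<le> real n * Q ^ n * step_error s n g"
    by (simp add: n_eq)
  have "cmod (char s (2 * g) - 1) \<le> \<bar>s\<bar> * real (2 * g)"
    using char_diff_le[of s 0 "2 * g"] by (simp add: char_def S_def prob_space)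
  moreover have "q ^ r \<le> Q ^ n" using power_mono[OF qQ q0, of r] QrQn by linarith
  ultimately have 2: "cmod (complex_of_real q ^ r * char s (2 * g) - complex_of_real q ^ r) \<le> Q ^ n * (\<bar>s\<bar> * real (2 * g))"
  proof -
    assume *: "cmod (char s (2 * g) - 1) \<le> \<bar>s\<bar> * real (2 * g)" "q ^ r \<le> Q ^ n"
    have "complex_of_real q ^ r * char s (2 * g) - complex_of_real q ^ r = complex_of_real q ^ r * (char s (2 * g) - 1)"
      by (simp add: algebra_simps)
    then have "cmod (complex_of_real q ^ r * char s (2 * g) - complex_of_real q ^ r) = q ^ r * cmod (char s (2 * g) - 1)"
      using q0 by (simp add: norm_mult norm_power)
    also have "\<dots> \<le> Q ^ n * (\<bar>s\<bar> * real (2 * g))"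
      using * Q by (intro mult_mono) auto
    finally show ?thesis .
  qed
  have "cmod (char s n - complex_of_real q ^ r) \<le> real n * Q ^ n * step_error s n g + Q ^ n * (\<bar>s\<bar> * real (2 * g))"
    using norm_triangle_ineq[of "char s n - complex_of_real q ^ r * char s (2 * g)"
        "complex_of_real q ^ r * char s (2 * g) - complex_of_real q ^ r"] 1 2 by simp
  moreover have "complex_of_real q ^ r = complex_of_real (exp (- (real (n - 2 * g) * (s\<^sup>2 / 2 * v))))"
    unfolding q_def r_def by (simp add: exp_of_nat_mult[symmetric] flip: of_real_power)
  moreover have "Q ^ n = exp (real n * (s\<^sup>2 / 2 * \<bar>v\<bar>))"
    unfolding Q_def by (simp only: exp_of_nat_mult)
  ultimately show ?thesis by (simp add: algebra_simps)
qed

end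

section \<open>Gap length and the limit of the characteristic functions\<close>

definition gap :: "nat \<Rightarrow> nat" where "gap n = nat \<lceil>real n powr (1 / 8)\<rceil>"

lemma gap_pos: "n > 0 \<Longrightarrow> gap n > 0"
  by (simp add: gap_def)

lemma gap_le: "gap n \<le> n"
proof (cases "n = 0")
  case False
  then have "real n powr (1 / 8) \<le> real n powr 1" by (intro powr_mono) auto
  then show ?thesis by (simp add: gap_def nat_le_iff ceiling_le_iff)
qed (simp add: gap_def)

lemma gap_at_top: "filterlim gap at_top sequentially"
  unfolding gap_def by real_asymp

lemma gap_sqrt_tendsto: "(\<lambda>n. (real (gap n))\<^sup>2 / sqrt (real n)) \<longlonglongrightarrow> 0"
  unfolding gap_def by real_asymp

lemma gap_over_sqrt_tendsto: "(\<lambda>n. real (gap n) / sqrt (real n)) \<longlonglongrightarrow> 0"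
  unfolding gap_def by real_asymp

lemma gap_over_tendsto: "(\<lambda>n. real (gap n) / real n) \<longlonglongrightarrow> 0"
  unfolding gap_def by real_asymp

text \<open>This pays for every polynomial loss: the number of factors, of time steps and of cells,
  and the slopes of the tents.\<close>

lemma power_times_power_gap_tendsto:
  assumes "0 < \<delta>" "\<delta> < 1"
  shows "(\<lambda>n. real n ^ k * \<delta> ^ gap n) \<longlonglongrightarrow> 0"
proof (rule tendsto_sandwich[where f = "\<lambda>_. 0"])
  define c where "c = - ln \<delta>"
  have c: "c > 0" using assms by (simp add: c_def)
  show "(\<lambda>n. real n ^ k * exp (- c * real n powr (1 / 8))) \<longlonglongrightarrow> 0"
    using c by real_asymp
  show "\<forall>\<^sub>F n in sequentially. real n ^ k * \<delta> ^ gap n \<le> real n ^ k * exp (- c * real n powr (1 / 8))"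
  proof (intro always_eventually allI mult_left_mono)
    fix n
    have "\<delta> ^ gap n = exp (- c * real (gap n))"
      using assms by (simp add: c_def exp_of_nat2_mult)
    also have "\<dots> \<le> exp (- c * real n powr (1 / 8))"
      using c by (simp add: gap_def real_nat_ceiling_ge)
    finally show "\<delta> ^ gap n \<le> exp (- c * real n powr (1 / 8))" .
  qed simp
qed (use assms in auto)

context decorrelated_observable
begin

text \<open>Over \<open>n\<close> steps the Taylor errors sum to order g^2 / sqrt n and the
  decorrelation errors to order n^2 \<delta>^g. The truncation of the variance is multiplied by n
  s^2 = t^2, so it only needs g to tend to infinity.\<close>

lemma scaled_step_error_tendsto: "(\<lambda>n. real n * step_error (t / sqrt (real n)) n (gap n)) \<longlonglongrightarrow> 0"
proof -
  define v where "v = asymptotic_variance M T f"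
  \<comment> \<open>The first factor comes from \<open>\<bar>s\<bar> \<le> \<bar>t\<bar>\<close> and
    s^2 (g + 1) \<le> 2 t^2, the second from bounding \<open>decay\<close> by \<open>n\<close> times
    a constant. Of the two powers of \<open>n\<close> accompanying \<open>K\<close>, one counts
    factors and one counts steps.\<close>
  define K where "K = (\<bar>t\<bar> + 2 * t\<^sup>2) * (C * (1 + \<bar>t\<bar> * L + 2 * L))"
  have K: "K \<ge> 0" unfolding K_def using C_pos L_nonneg by simp
  define err where "err n = 6 * \<bar>t\<bar> ^ 3 * ((real (gap n))\<^sup>2 / sqrt (real n)) + K * (real n ^ 2 * \<delta> ^ gap n)
      + t\<^sup>2 / 2 * \<bar>v - var_upto (gap n)\<bar> + exp (t\<^sup>2 / 2 * \<bar>v\<bar>) * (t\<^sup>2 / 2 * v)\<^sup>2 * (1 / real n)" for n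
  have var: "(\<lambda>n. var_upto (gap n)) \<longlonglongrightarrow> v"
    unfolding v_def by (rule filterlim_compose[OF var_upto_tendsto gap_at_top])
  have inv: "(\<lambda>n. 1 / real n) \<longlonglongrightarrow> 0" by real_asymp
  have "err \<longlonglongrightarrow> 6 * \<bar>t\<bar> ^ 3 * 0 + K * 0 + t\<^sup>2 / 2 * \<bar>v - v\<bar> + exp (t\<^sup>2 / 2 * \<bar>v\<bar>) * (t\<^sup>2 / 2 * v)\<^sup>2 * 0"
    unfolding err_def[abs_def]
    by (intro tendsto_intros var inv gap_sqrt_tendsto power_times_power_gap_tendsto \<delta>_pos \<delta>_less_1)
  then have err0: "err \<longlonglongrightarrow> 0" by simp
  have bound: "real n * step_error (t / sqrt (real n)) n (gap n) \<le> err n" if n: "n > 0" for n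
  proof -
    define s where "s = t / sqrt (real n)"
    have n1: "real n \<ge> 1" using n by simp
    have sq: "sqrt (real n) \<ge> 1" "sqrt (real n) * sqrt (real n) = real n" using n1 by auto
    have s2: "s\<^sup>2 = t\<^sup>2 / real n" unfolding s_def by (simp add: power_divide)
    have abs_s: "\<bar>s\<bar> = \<bar>t\<bar> / sqrt (real n)" unfolding s_def by simp
    have s_le: "\<bar>s\<bar> \<le> \<bar>t\<bar>" unfolding abs_s using sq(1) by (simp add: divide_le_eq mult_le_cancel_left1)
    have 1: "real n * (6 * \<bar>s\<bar> ^ 3 * (real (gap n))\<^sup>2) = 6 * \<bar>t\<bar> ^ 3 * ((real (gap n))\<^sup>2 / sqrt (real n))"
      unfolding abs_s power3_eq_cube using n sq by (simp add: field_simps)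
    have 2: "real n * ((\<bar>s\<bar> + s\<^sup>2 * (real (gap n) + 1)) * decay s n (gap n)) \<le> K * (real n ^ 2 * \<delta> ^ gap n)"
    proof -
      have g: "real (gap n) \<le> real n" using gap_le by simp
      have "s\<^sup>2 * (real (gap n) + 1) \<le> s\<^sup>2 * (2 * real n)"
        using g n1 by (intro mult_left_mono) auto
      also have "\<dots> = 2 * t\<^sup>2" using n by (simp add: s2)
      finally have a: "\<bar>s\<bar> + s\<^sup>2 * (real (gap n) + 1) \<le> \<bar>t\<bar> + 2 * t\<^sup>2" using s_le by linarith
      have "1 + real n * \<bar>s\<bar> * L + 2 * L \<le> real n * 1 + real n * (\<bar>t\<bar> * L) + real n * (2 * L)"
        using n1 s_le L_nonneg mult_right_mono[OF n1, of "2 * L"]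
        by (intro add_mono) (auto simp: mult.assoc mult_right_mono)
      also have "\<dots> = real n * (1 + \<bar>t\<bar> * L + 2 * L)" by (simp add: algebra_simps)
      finally have "decay s n (gap n) \<le> C * (real n * (1 + \<bar>t\<bar> * L + 2 * L)) * \<delta> ^ gap n"
        unfolding decay_def using C_pos \<delta>_pos by (intro mult_right_mono mult_left_mono) auto
      then have "real n * ((\<bar>s\<bar> + s\<^sup>2 * (real (gap n) + 1)) * decay s n (gap n))
          \<le> real n * ((\<bar>t\<bar> + 2 * t\<^sup>2) * (C * (real n * (1 + \<bar>t\<bar> * L + 2 * L)) * \<delta> ^ gap n))"
        using a decay_nonneg by (intro mult_left_mono mult_mono) auto
      also have "\<dots> = K * (real n ^ 2 * \<delta> ^ gap n)"
        unfolding K_def by (simp add: power2_eq_square mult_ac)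
      finally show ?thesis .
    qed
    have 3: "real n * (s\<^sup>2 / 2 * \<bar>v - var_upto (gap n)\<bar>) = t\<^sup>2 / 2 * \<bar>v - var_upto (gap n)\<bar>"
      using n by (simp add: s2)
    have 4: "real n * (exp (s\<^sup>2 / 2 * \<bar>v\<bar>) * (s\<^sup>2 / 2 * v)\<^sup>2) \<le> exp (t\<^sup>2 / 2 * \<bar>v\<bar>) * (t\<^sup>2 / 2 * v)\<^sup>2 * (1 / real n)"
    proof -
      have "real n * (s\<^sup>2 / 2 * v)\<^sup>2 = (t\<^sup>2 / 2 * v)\<^sup>2 * (1 / real n)"
      proof -
        have "s\<^sup>2 / 2 * v = (t\<^sup>2 / 2 * v) / real n" by (simp add: s2)
        then show ?thesis using n by (simp add: power_divide) (simp add: power2_eq_square)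
      qed
      moreover have "s\<^sup>2 \<le> t\<^sup>2" using s_le by (simp add: abs_le_square_iff)
      then have "s\<^sup>2 / 2 * \<bar>v\<bar> \<le> t\<^sup>2 / 2 * \<bar>v\<bar>" by (intro mult_right_mono) auto
      then have "exp (s\<^sup>2 / 2 * \<bar>v\<bar>) * ((t\<^sup>2 / 2 * v)\<^sup>2 * (1 / real n))
          \<le> exp (t\<^sup>2 / 2 * \<bar>v\<bar>) * ((t\<^sup>2 / 2 * v)\<^sup>2 * (1 / real n))"
        by (intro mult_right_mono) auto
      ultimately show ?thesis by (simp only: mult.assoc mult.left_commute[of "real n"])
    qed
    have "real n * step_error s n (gap n) = real n * (6 * \<bar>s\<bar> ^ 3 * (real (gap n))\<^sup>2)
        + real n * ((\<bar>s\<bar> + s\<^sup>2 * (real (gap n) + 1)) * decay s n (gap n))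
        + real n * (s\<^sup>2 / 2 * \<bar>v - var_upto (gap n)\<bar>) + real n * (exp (s\<^sup>2 / 2 * \<bar>v\<bar>) * (s\<^sup>2 / 2 * v)\<^sup>2)"
      unfolding step_error_def v_def by (simp only: distrib_left)
    then show ?thesis using 1 2 3 4 unfolding err_def s_def[symmetric] by linarith
  qed
  show ?thesis
  proof (rule tendsto_sandwich[OF _ _ tendsto_const err0])
    show "\<forall>\<^sub>F n in sequentially. 0 \<le> real n * step_error (t / sqrt (real n)) n (gap n)"
      using step_error_nonneg by simp
    show "\<forall>\<^sub>F n in sequentially. real n * step_error (t / sqrt (real n)) n (gap n) \<le> err n"
      using bound by (intro eventually_sequentiallyI[of 1]) auto
  qed
qed

lemma central_limit:
  "(\<lambda>n. char (t / sqrt (real n)) n) \<longlonglongrightarrow> exp (- (1 / 2) * asymptotic_variance M T f * t\<^sup>2)"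
proof -
  define v where "v = asymptotic_variance M T f"
  define s where "s n = t / sqrt (real n)" for n :: nat
  have s2: "(s n)\<^sup>2 = t\<^sup>2 / real n" for n unfolding s_def by (simp add: power_divide)
  define z where "z n = exp (- (real (n - 2 * gap n) * ((s n)\<^sup>2 / 2 * v)))" for n
  define e where "e n = exp (t\<^sup>2 / 2 * \<bar>v\<bar>) * (real n * step_error (s n) n (gap n) + 2 * \<bar>t\<bar> * (real (gap n) / sqrt (real n)))" for n
  have "\<forall>\<^sub>F n in sequentially. real (gap n) / real n < 1 / 2"
    using gap_over_tendsto by (rule order_tendstoD) simp
  then have large: "\<forall>\<^sub>F n in sequentially. n > 0 \<and> 2 * gap n \<le> n"
    using eventually_gt_at_top[of 0] by eventually_elim (simp add: divide_less_eq)
  \<comment> \<open>Only \<open>n - 2 * gap n\<close> of the \<open>n\<close> steps contribute a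
    Gaussian factor; their proportion tends to 1.\<close>
  have "(\<lambda>n. exp (- ((1 - 2 * (real (gap n) / real n)) * (t\<^sup>2 / 2 * v)))) \<longlonglongrightarrow> exp (- ((1 - 2 * 0) * (t\<^sup>2 / 2 * v)))"
    by (intro tendsto_intros gap_over_tendsto)
  moreover have "\<forall>\<^sub>F n in sequentially. exp (- ((1 - 2 * (real (gap n) / real n)) * (t\<^sup>2 / 2 * v))) = z n"
    using large
  proof eventually_elim
    case (elim n)
    then have "real (n - 2 * gap n) * ((s n)\<^sup>2 / 2 * v) = (1 - 2 * (real (gap n) / real n)) * (t\<^sup>2 / 2 * v)"
    proof -
      have "real (n - 2 * gap n) = real n * (1 - 2 * (real (gap n) / real n))"
        using elim by (simp add: of_nat_diff right_diff_distrib)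
      moreover have "real n * ((s n)\<^sup>2 / 2 * v) = t\<^sup>2 / 2 * v" using elim by (simp add: s2)
      moreover have "real n * c * w = c * (real n * w)" for c w by simp
      ultimately show ?thesis by (simp only:)
    qed
    then show ?case unfolding z_def by (simp only:)
  qed
  ultimately have "z \<longlonglongrightarrow> exp (- ((1 - 2 * 0) * (t\<^sup>2 / 2 * v)))" by (rule Lim_transform_eventually)
  then have "z \<longlonglongrightarrow> exp (- (1 / 2) * v * t\<^sup>2)" by (simp add: mult_ac)
  then have z: "(\<lambda>n. complex_of_real (z n)) \<longlonglongrightarrow> complex_of_real (exp (- (1 / 2) * v * t\<^sup>2))"
    by (rule tendsto_of_real)
  have "e \<longlonglongrightarrow> exp (t\<^sup>2 / 2 * \<bar>v\<bar>) * (0 + 2 * \<bar>t\<bar> * 0)"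
    unfolding e_def[abs_def] s_def
    by (intro tendsto_intros scaled_step_error_tendsto gap_over_sqrt_tendsto)
  then have e0: "e \<longlonglongrightarrow> 0" by simp
  have "\<forall>\<^sub>F n in sequentially. cmod (char (s n) n - z n) \<le> e n"
    using large
  proof eventually_elim
    case (elim n)
    have "cmod (char (s n) n - z n) \<le> exp (real n * ((s n)\<^sup>2 / 2 * \<bar>v\<bar>))
        * (real n * step_error (s n) n (gap n) + \<bar>s n\<bar> * real (2 * gap n))"
      unfolding z_def v_def by (rule char_estimate) (use gap_pos elim in auto)
    moreover have "real n * ((s n)\<^sup>2 / 2 * \<bar>v\<bar>) = t\<^sup>2 / 2 * \<bar>v\<bar>" using elim by (simp add: s2)
    moreover have "\<bar>s n\<bar> * real (2 * gap n) = 2 * \<bar>t\<bar> * (real (gap n) / sqrt (real n))"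
      unfolding s_def by simp
    ultimately show ?case unfolding e_def by (simp only:)
  qed
  then have "(\<lambda>n. char (s n) n - z n) \<longlonglongrightarrow> 0" by (rule Lim_null_comparison[OF _ e0])
  from tendsto_add[OF this z] show ?thesis unfolding s_def v_def by simp
qed

end

section \<open>Decoupling the parameter from the orbit\<close>

text \<open>The plateau on the ball of radius \<epsilon> makes the partition exact on covered
  points; the support in the ball of radius 2 \<epsilon> limits the error of freezing a
  parameter.\<close>

definition tent :: "real \<Rightarrow> 'a::metric_space \<Rightarrow> 'a \<Rightarrow> real" where
  "tent \<epsilon> p x = max 0 (min 1 (2 - dist x p / \<epsilon>))"

lemma tent_bounds: "0 \<le> tent \<epsilon> p x" "tent \<epsilon> p x \<le> 1"
  by (auto simp: tent_def)

lemma tent_eq_1: "\<epsilon> > 0 \<Longrightarrow> dist x p \<le> \<epsilon> \<Longrightarrow> tent \<epsilon> p x = 1"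
  by (auto simp: tent_def min_def max_def divide_le_eq)

lemma tent_nonzero_imp: "\<epsilon> > 0 \<Longrightarrow> tent \<epsilon> p x \<noteq> 0 \<Longrightarrow> dist x p \<le> 2 * \<epsilon>"
  by (auto simp: tent_def min_def max_def divide_le_eq split: if_splits)

lemma continuous_on_tent [continuous_intros]: "continuous_on S (tent \<epsilon> p)"
  unfolding tent_def[abs_def] divide_inverse by (intro continuous_intros)

text \<open>At distances up to 1 the Lipschitz bound is stronger than the Hoelder bound because
  \<open>\<alpha> \<le> 1\<close>; beyond 1 the oscillation is at most 1, and
  \<open>1 / \<epsilon>\<close> is at least 1.\<close>

lemma tent_hoelder:
  assumes \<epsilon>: "0 < \<epsilon>" "\<epsilon> \<le> 1" and \<alpha>: "0 < \<alpha>" "\<alpha> \<le> 1"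
  shows "\<bar>tent \<epsilon> p x - tent \<epsilon> p y\<bar> \<le> 1 / \<epsilon> * dist x y powr \<alpha>"
proof (cases "dist x y \<le> 1")
  case True
  have "\<bar>tent \<epsilon> p x - tent \<epsilon> p y\<bar> \<le> \<bar>dist x p / \<epsilon> - dist y p / \<epsilon>\<bar>"
    unfolding tent_def by linarith
  also have "\<dots> = \<bar>dist x p - dist y p\<bar> / \<epsilon>" using \<epsilon> by (simp flip: diff_divide_distrib)
  also have "\<dots> \<le> dist x y / \<epsilon>"
    using \<epsilon> abs_dist_diff_le[of x p y] by (intro divide_right_mono) (auto simp: dist_commute)
  also have "dist x y \<le> dist x y powr \<alpha>"
    using powr_mono'[of \<alpha> 1 "dist x y"] \<alpha> True by simp
  finally show ?thesis using \<epsilon> by (simp add: divide_right_mono)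
next
  case False
  have "\<bar>tent \<epsilon> p x - tent \<epsilon> p y\<bar> \<le> 1 * 1"
    using tent_bounds[of \<epsilon> p x] tent_bounds[of \<epsilon> p y] by linarith
  also have "\<dots> \<le> 1 / \<epsilon> * dist x y powr \<alpha>"
    using \<epsilon> \<alpha> False by (intro mult_mono) (auto simp: ge_one_powr_ge_zero)
  finally show ?thesis .
qed

text \<open>
  A partition of unity obtained by greedy disjointification. Its members are products of tent
  functions, to which multiple decorrelation applies factor by factor.
\<close>

definition bump :: "real \<Rightarrow> (nat \<Rightarrow> 'a::metric_space) \<Rightarrow> nat \<Rightarrow> 'a \<Rightarrow> real" where
  "bump \<epsilon> p j x = (\<Prod>i<j. 1 - tent \<epsilon> (p i) x) * tent \<epsilon> (p j) x"

definition uncovered :: "real \<Rightarrow> (nat \<Rightarrow> 'a::metric_space) \<Rightarrow> nat \<Rightarrow> 'a \<Rightarrow> real" where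
  "uncovered \<epsilon> p n x = (\<Prod>i<n. 1 - tent \<epsilon> (p i) x)"

lemma uncovered_bounds: "0 \<le> uncovered \<epsilon> p n x" "uncovered \<epsilon> p n x \<le> 1"
  unfolding uncovered_def using tent_bounds by (auto intro!: prod_nonneg prod_le_1)

lemma bump_eq: "bump \<epsilon> p j x = uncovered \<epsilon> p j x * tent \<epsilon> (p j) x"
  by (simp add: bump_def uncovered_def)

lemma bump_bounds: "0 \<le> bump \<epsilon> p j x" "bump \<epsilon> p j x \<le> 1"
  unfolding bump_eq by (simp_all add: uncovered_bounds tent_bounds mult_le_one)

text \<open>The sum telescopes: \<open>bump \<epsilon> p j x\<close> is \<open>uncovered\<close> at
  \<open>j\<close> minus \<open>uncovered\<close> at \<open>Suc j\<close>.\<close>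

lemma sum_bump: "(\<Sum>j<n. bump \<epsilon> p j x) = 1 - uncovered \<epsilon> p n x"
  by (induction n) (simp_all add: uncovered_def bump_def algebra_simps)

lemma uncovered_eq_0:
  assumes "\<epsilon> > 0" "j < n" "dist x (p j) \<le> \<epsilon>"
  shows "uncovered \<epsilon> p n x = 0"
  unfolding uncovered_def using assms tent_eq_1[of \<epsilon> x "p j"]
  by (intro prod_zero) (auto intro: bexI[of _ j])

lemma continuous_on_uncovered [continuous_intros]: "continuous_on S (uncovered \<epsilon> p n)"
  unfolding uncovered_def[abs_def] by (intro continuous_intros)

lemma continuous_on_bump [continuous_intros]: "continuous_on S (bump \<epsilon> p j)"
  unfolding bump_def[abs_def] by (intro continuous_intros)

text \<open>The centres have to lie in \<open>K\<close>, because uniform regularity of the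
  observables is known only there. So sets missing \<open>K\<close> are discarded, and a
  representative in \<open>K\<close> is chosen from each of the others.\<close>

lemma polynomially_covered_net:
  fixes K :: "'a::metric_space set"
  assumes "polynomially_covered K"
  obtains a d :: nat and B :: real where "B \<ge> 1"
    "\<And>k::nat. k \<ge> 1 \<Longrightarrow> \<exists>N (p :: nat \<Rightarrow> 'a). N \<le> a * k ^ d \<and> (\<forall>j<N. p j \<in> K) \<and>
       (\<forall>x\<in>K. \<exists>j<N. dist x (p j) \<le> B / real k)"
proof -
  obtain a d B where cov: "\<And>k. k \<ge> 1 \<Longrightarrow> \<exists>\<U>. finite \<U> \<and> card \<U> \<le> a * k ^ d \<and> K \<subseteq> \<Union>\<U> \<and>
        (\<forall>U\<in>\<U>. \<forall>x\<in>U. \<forall>y\<in>U. dist x y \<le> B / real k)"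
    using assms unfolding polynomially_covered_def by blast
  show ?thesis
  proof (rule that[of "max 1 B" a d])
    fix k :: nat assume k: "k \<ge> 1"
    obtain \<U> where U: "finite \<U>" "card \<U> \<le> a * k ^ d" "K \<subseteq> \<Union>\<U>"
      "\<forall>U\<in>\<U>. \<forall>x\<in>U. \<forall>y\<in>U. dist x y \<le> B / real k"
      using cov[OF k] by (elim exE conjE) (rule that)
    define c where "c U = (SOME x. x \<in> U \<inter> K)" for U
    define \<V> where "\<V> = {U \<in> \<U>. U \<inter> K \<noteq> {}}"
    have c: "c U \<in> U \<inter> K" if "U \<in> \<V>" for U
    proof -
      have "\<exists>x. x \<in> U \<inter> K" using that unfolding \<V>_def by blast
      then show ?thesis unfolding c_def by (rule someI_ex)
    qed
    have V: "finite \<V>" "card \<V> \<le> card \<U>"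
      unfolding \<V>_def using U(1) by (auto intro: card_mono)
    have "card (c ` \<V>) \<le> a * k ^ d"
      using card_image_le[OF V(1), of c] V(2) U(2) by linarith
    moreover obtain p where p: "bij_betw p {0..<card (c ` \<V>)} (c ` \<V>)"
      using ex_bij_betw_nat_finite V(1) by blast
    have "p j \<in> K" if "j < card (c ` \<V>)" for j
    proof -
      have "p j \<in> c ` \<V>" using bij_betwE[OF p] that by auto
      then show ?thesis using c by auto
    qed
    moreover have "\<exists>j<card (c ` \<V>). dist x (p j) \<le> max 1 B / real k" if x: "x \<in> K" for x
    proof -
      obtain U where U': "U \<in> \<U>" "x \<in> U" using U(3) x by blast
      then have UV: "U \<in> \<V>" unfolding \<V>_def using x by blast
      then have "c U \<in> p ` {0..<card (c ` \<V>)}" using p by (simp add: bij_betw_def)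
      then obtain j where j: "j < card (c ` \<V>)" "p j = c U" by auto
      have "dist x (p j) \<le> B / real k" unfolding j(2) using U(4) U' c[OF UV] by blast
      also have "\<dots> \<le> max 1 B / real k" by (intro divide_right_mono) auto
      finally show ?thesis using j(1) by blast
    qed
    ultimately show "\<exists>N p. N \<le> a * k ^ d \<and> (\<forall>j<N. p j \<in> K) \<and>
       (\<forall>x\<in>K. \<exists>j<N. dist x (p j) \<le> max 1 B / real k)"
      by (intro exI[of _ "card (c ` \<V>)"] exI[of _ p]) auto
  qed simp
qed

section \<open>Families of observables with a random parameter\<close>

text \<open>\<open>h y\<close> stands for the observable with parameter \<open>y\<close>, centered
  and scaled into [-1, 1]. The exponent in \<open>h_hoelder\<close> may depend on \<open>y\<close>,
  while \<open>h_param\<close> is uniform in the point. Of the Riemannian structure only the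
  exhaustion \<open>W\<close> and the two points \<open>a0\<close>, \<open>b0\<close> are
  retained.\<close>

locale observable_family = pmp_dynamics +
  fixes h :: "'a \<Rightarrow> 'a \<Rightarrow> real" and D \<gamma> :: real and W :: "nat \<Rightarrow> 'a set" and a0 b0 :: 'a
  assumes md: "multiple_decorrelation M T"
    and nontrivial: "a0 \<noteq> b0"
    and h_le_1: "\<And>y z. \<bar>h y z\<bar> \<le> 1"
    and h_hoelder: "\<And>y. \<exists>\<kappa>>0. \<exists>L. \<forall>z z'. \<bar>h y z - h y z'\<bar> \<le> L * dist z z' powr \<kappa>"
    and h_param: "\<And>y y' z. \<bar>h y z - h y' z\<bar> \<le> D * dist y y' powr \<gamma>"
    and D_nonneg: "D \<ge> 0" and \<gamma>_pos: "\<gamma> > 0"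
    and h_centered: "\<And>y. (LINT z|M. h y z) = 0"
    and W: "\<And>n. open (W n)" "\<And>n. polynomially_covered (W n)" "mono W" "(\<Union>n. W n) = UNIV"
begin

text \<open>Moving the parameter first, at the fixed point \<open>v i\<close>, leaves only the
  Hoelder constant of the limiting observable \<open>h y\<close>. Joint continuity is what makes the
  diagonal terms \<open>h x ((T ^^ k) x)\<close> measurable.\<close>

lemma h_tendsto:
  assumes "(u \<longlongrightarrow> y) F" "(v \<longlongrightarrow> z) F"
  shows "((\<lambda>i. h (u i) (v i)) \<longlongrightarrow> h y z) F"
proof -
  obtain \<kappa> L where \<kappa>: "\<kappa> > 0" "\<And>z z'. \<bar>h y z - h y z'\<bar> \<le> L * dist z z' powr \<kappa>"
    using h_hoelder by blast
  have 0: "((\<lambda>i. dist (u i) y) \<longlongrightarrow> 0) F" "((\<lambda>i. dist (v i) z) \<longlongrightarrow> 0) F"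
    using assms by (simp_all flip: tendsto_dist_iff)
  have "((\<lambda>i. D * dist (u i) y powr \<gamma> + L * dist (v i) z powr \<kappa>) \<longlongrightarrow> D * 0 + L * 0) F"
    using tendsto_powr'[OF 0(1) tendsto_const, of \<gamma>] tendsto_powr'[OF 0(2) tendsto_const, of \<kappa>] \<gamma>_pos \<kappa>(1)
    by (intro tendsto_intros) auto
  then have lim: "((\<lambda>i. D * dist (u i) y powr \<gamma> + L * dist (v i) z powr \<kappa>) \<longlongrightarrow> 0) F" by simp
  have "((\<lambda>i. h (u i) (v i) - h y z) \<longlongrightarrow> 0) F"
  proof (rule Lim_null_comparison[OF _ lim], intro always_eventually allI)
    fix i
    have "\<bar>h (u i) (v i) - h y (v i)\<bar> \<le> D * dist (u i) y powr \<gamma>" by (rule h_param)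
    moreover have "\<bar>h y (v i) - h y z\<bar> \<le> L * dist (v i) z powr \<kappa>" by (rule \<kappa>)
    ultimately show "norm (h (u i) (v i) - h y z) \<le> D * dist (u i) y powr \<gamma> + L * dist (v i) z powr \<kappa>"
      by simp
  qed
  then show ?thesis by (simp add: LIM_zero_iff)
qed

lemma continuous_on_h: "continuous_on UNIV (\<lambda>q. h (fst q) (snd q))"
  unfolding continuous_on_def by (intro ballI h_tendsto tendsto_intros)

lemma continuous_on_h_param: "continuous_on UNIV (\<lambda>y. h y z)"
  unfolding continuous_on_def by (auto intro!: h_tendsto)

lemma ident_borel_measurable: "(\<lambda>x. x) \<in> borel_measurable M"
  by (intro continuous_borel_measurable continuous_on_id)

lemma T_pow_borel_measurable: "(\<lambda>x. (T ^^ k) x) \<in> borel_measurable M"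
  using measurable_comp[OF T_pow_measurable ident_borel_measurable, of k] by (simp add: o_def)

lemma h_diag_measurable [measurable]: "(\<lambda>x. h x ((T ^^ k) x)) \<in> borel_measurable M"
  by (rule borel_measurable_continuous_Pair[OF ident_borel_measurable T_pow_borel_measurable continuous_on_h])

lemma h_measurable [measurable]: "h y \<in> borel_measurable M"
  by (intro continuous_borel_measurable) (auto simp: continuous_on_def intro!: h_tendsto)

text \<open>One index controls both the exponent and the constant. Capping the distance at 1 makes
  the sets increase with \<open>m\<close>, since lowering the exponent enlarges only the powers of
  numbers up to 1.\<close>

definition regular :: "nat \<Rightarrow> 'a set" where
  "regular m = {y. \<forall>z z'. \<bar>h y z - h y z'\<bar> \<le> real (Suc m) * min 1 (dist z z') powr (1 / real (Suc m))}"

lemma regularD: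
  assumes "y \<in> regular m"
  shows "\<bar>h y z - h y z'\<bar> \<le> real (Suc m) * dist z z' powr (1 / real (Suc m))"
proof -
  have "\<bar>h y z - h y z'\<bar> \<le> real (Suc m) * min 1 (dist z z') powr (1 / real (Suc m))"
    using assms unfolding regular_def by blast
  also have "\<dots> \<le> real (Suc m) * dist z z' powr (1 / real (Suc m))"
    by (intro mult_left_mono powr_mono2) auto
  finally show ?thesis .
qed

text \<open>For fixed \<open>z\<close> and \<open>z'\<close> the condition is closed in the
  parameter; closedness supplies the measurability of the good sets.\<close>

lemma closed_regular: "closed (regular m)"
  unfolding regular_def
  by (intro closed_Collect_all closed_Collect_le continuous_intros continuous_on_h_param)

lemma mono_regular: "mono regular"
proof (rule monoI, rule subsetI)
  fix m n :: nat and y assume mn: "m \<le> n" and y: "y \<in> regular m"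
  show "y \<in> regular n" unfolding regular_def
  proof (intro CollectI allI)
    fix z z'
    have "\<bar>h y z - h y z'\<bar> \<le> real (Suc m) * min 1 (dist z z') powr (1 / real (Suc m))"
      using y unfolding regular_def by blast
    also have "\<dots> \<le> real (Suc n) * min 1 (dist z z') powr (1 / real (Suc n))"
      using mn by (intro mult_mono powr_mono') (auto simp: frac_le)
    finally show "\<bar>h y z - h y z'\<bar> \<le> real (Suc n) * min 1 (dist z z') powr (1 / real (Suc n))" .
  qed
qed

lemma Union_regular: "(\<Union>m. regular m) = UNIV"
proof -
  have "\<exists>m. y \<in> regular m" for y
  proof -
    obtain \<kappa> L where \<kappa>: "\<kappa> > 0" "\<And>z z'. \<bar>h y z - h y z'\<bar> \<le> L * dist z z' powr \<kappa>"
      using h_hoelder by blast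
    obtain m :: nat where m: "max (max L 2) (1 / \<kappa>) \<le> real m" using real_arch_simple by blast
    have "1 / real (Suc m) \<le> \<kappa>"
    proof -
      have "1 \<le> real m * \<kappa>" using m \<kappa>(1) by (simp add: divide_le_eq)
      also have "\<dots> \<le> real (Suc m) * \<kappa>" using \<kappa>(1) by (intro mult_right_mono) auto
      finally show ?thesis by (simp add: divide_le_eq mult.commute)
    qed
    have "\<bar>h y z - h y z'\<bar> \<le> real (Suc m) * min 1 (dist z z') powr (1 / real (Suc m))" for z z'
    proof (cases "dist z z' \<le> 1")
      case True
      have "\<bar>h y z - h y z'\<bar> \<le> L * dist z z' powr \<kappa>" by (rule \<kappa>)
      also have "\<dots> \<le> real (Suc m) * dist z z' powr (1 / real (Suc m))"
        using m True \<open>1 / real (Suc m) \<le> \<kappa>\<close> by (intro mult_mono powr_mono') auto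
      finally show ?thesis using True by (simp add: min_def)
    next
      case False
      have "\<bar>h y z - h y z'\<bar> \<le> 2" using h_le_1[of y z] h_le_1[of y z'] by linarith
      then show ?thesis using m False by simp
    qed
    then show ?thesis unfolding regular_def by blast
  qed
  then show ?thesis by blast
qed

definition F :: "real \<Rightarrow> nat \<Rightarrow> nat \<Rightarrow> 'a \<Rightarrow> 'a \<Rightarrow> complex" where
  "F s g n y x = iexp (s * (\<Sum>k<n - g. h y ((T ^^ (g + k)) x)))"

definition G :: "real \<Rightarrow> nat \<Rightarrow> nat \<Rightarrow> 'a \<Rightarrow> complex" where
  "G s g n y = (LINT x|M. F s g n y x)"

lemma cmod_F: "cmod (F s g n y x) = 1"
  by (simp add: F_def)

lemma cmod_G: "cmod (G s g n y) \<le> 1"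
  unfolding G_def by (rule integral_norm_le) (auto simp: cmod_F)

lemma F_measurable [measurable]: "F s g n y \<in> borel_measurable M"
  unfolding F_def[abs_def] by measurable

lemma F_diag_measurable [measurable]: "(\<lambda>x. F s g n x x) \<in> borel_measurable M"
  unfolding F_def[abs_def] by measurable

lemma cmod_iexp_sum_diff_le:
  fixes u v :: "nat \<Rightarrow> real"
  assumes "\<And>k. k < n \<Longrightarrow> \<bar>u k - v k\<bar> \<le> e"
  shows "cmod (iexp (s * (\<Sum>k<n. u k)) - iexp (s * (\<Sum>k<n. v k))) \<le> \<bar>s\<bar> * (real n * e)"
proof -
  have "cmod (iexp (s * (\<Sum>k<n. u k)) - iexp (s * (\<Sum>k<n. v k))) \<le> \<bar>s * (\<Sum>k<n. u k) - s * (\<Sum>k<n. v k)\<bar>"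
    by (rule cmod_iexp_diff_le)
  also have "\<dots> = \<bar>s\<bar> * \<bar>\<Sum>k<n. u k - v k\<bar>"
    by (simp add: sum_subtractf abs_mult flip: right_diff_distrib)
  also have "\<bar>\<Sum>k<n. u k - v k\<bar> \<le> (\<Sum>k<n. e)"
    by (rule order_trans[OF sum_abs]) (intro sum_mono, use assms in auto)
  finally show ?thesis by (simp add: mult_left_mono)
qed

lemma F_param:
  assumes "dist y y' \<le> \<rho>"
  shows "cmod (F s g n y x - F s g n y' x) \<le> \<bar>s\<bar> * (real n * (D * \<rho> powr \<gamma>))"
proof -
  have "cmod (F s g n y x - F s g n y' x) \<le> \<bar>s\<bar> * (real (n - g) * (D * \<rho> powr \<gamma>))"
    unfolding F_def
  proof (rule cmod_iexp_sum_diff_le)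
    fix k
    show "\<bar>h y ((T ^^ (g + k)) x) - h y' ((T ^^ (g + k)) x)\<bar> \<le> D * \<rho> powr \<gamma>"
      using assms D_nonneg \<gamma>_pos
      by (intro order_trans[OF h_param] mult_left_mono powr_mono2) auto
  qed
  also have "\<dots> \<le> \<bar>s\<bar> * (real n * (D * \<rho> powr \<gamma>))"
    using D_nonneg by (intro mult_left_mono mult_right_mono) auto
  finally show ?thesis .
qed

lemma F_integrable: "integrable M (F s g n y)" "integrable M (\<lambda>x. F s g n x x)"
  by (intro integrable_bounded[of _ 1]; simp add: cmod_F)+

lemma G_param:
  assumes "dist y y' \<le> \<rho>"
  shows "cmod (G s g n y - G s g n y') \<le> \<bar>s\<bar> * (real n * (D * \<rho> powr \<gamma>))"
proof -
  have "G s g n y - G s g n y' = (LINT x|M. F s g n y x - F s g n y' x)"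
    unfolding G_def using F_integrable by simp
  then show ?thesis
    using D_nonneg by (simp only:) (rule integral_norm_le, auto intro: F_param[OF assms])
qed

lemma G_measurable [measurable]: "G s g n \<in> borel_measurable M"
proof (rule continuous_borel_measurable)
  have "((\<lambda>y. G s g n y) \<longlongrightarrow> G s g n y0) (at y0)" for y0
  proof -
    have 0: "((\<lambda>y. dist y y0) \<longlongrightarrow> 0) (at y0)" by (simp flip: tendsto_dist_iff)
    have "((\<lambda>y. \<bar>s\<bar> * (real n * (D * dist y y0 powr \<gamma>))) \<longlongrightarrow> \<bar>s\<bar> * (real n * (D * 0))) (at y0)"
      using tendsto_powr'[OF 0 tendsto_const, of \<gamma>] \<gamma>_pos by (intro tendsto_intros) auto
    then have lim: "((\<lambda>y. \<bar>s\<bar> * (real n * (D * dist y y0 powr \<gamma>))) \<longlongrightarrow> 0) (at y0)" by simp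
    have "((\<lambda>y. G s g n y - G s g n y0) \<longlongrightarrow> 0) (at y0)"
      by (rule Lim_null_comparison[OF _ lim]) (intro always_eventually allI G_param order_refl)
    then show ?thesis by (simp add: LIM_zero_iff)
  qed
  then show "continuous_on UNIV (G s g n)" by (simp add: continuous_on_def)
qed

lemma F_gap:
  assumes "g \<le> n"
  shows "cmod (F s 0 n y x - F s g n y x) \<le> \<bar>s\<bar> * real g"
proof -
  have "(\<Sum>k<n. h y ((T ^^ k) x)) = (\<Sum>k<g. h y ((T ^^ k) x)) + (\<Sum>k<n - g. h y ((T ^^ (g + k)) x))"
    using sum_lessThan_add[of "\<lambda>k. h y ((T ^^ k) x)" g "n - g"] assms by simp
  then have "cmod (F s 0 n y x - F s g n y x) \<le> \<bar>s * (\<Sum>k<g. h y ((T ^^ k) x))\<bar>"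
    unfolding F_def by (intro order_trans[OF cmod_iexp_diff_le]) (simp flip: right_diff_distrib)
  also have "\<dots> \<le> \<bar>s\<bar> * (\<Sum>k<g. 1)"
    unfolding abs_mult by (intro mult_left_mono order_trans[OF sum_abs] sum_mono h_le_1) auto
  finally show ?thesis by simp
qed

lemma G_gap:
  assumes "g \<le> n"
  shows "cmod (G s 0 n y - G s g n y) \<le> \<bar>s\<bar> * real g"
proof -
  have "G s 0 n y - G s g n y = (LINT x|M. F s 0 n y x - F s g n y x)"
    unfolding G_def using F_integrable by simp
  then show ?thesis by (simp only:) (rule integral_norm_le, auto intro: F_gap[OF assms])
qed

text \<open>Stated for a general \<open>H\<close> because it is used twice: to freeze the parameter
  in \<open>F\<close> on the diagonal, and to undo this for \<open>G\<close>, which ignores the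
  second argument. Points off \<open>K\<close> may be left uncovered and cost their measure;
  elsewhere a nonzero bump puts \<open>x\<close> within \<open>2 * \<epsilon>\<close> of its centre,
  so freezing costs \<omega>.\<close>

lemma partition_estimate:
  fixes H :: "'a \<Rightarrow> 'a \<Rightarrow> complex"
  assumes \<epsilon>: "\<epsilon> > 0" and K: "K \<in> sets M" "\<And>x. x \<in> K \<Longrightarrow> \<exists>j<N. dist x (p j) \<le> \<epsilon>"
    and H_le_1: "\<And>y x. cmod (H y x) \<le> 1"
    and meas: "\<And>y. H y \<in> borel_measurable M" "(\<lambda>x. H x x) \<in> borel_measurable M"
    and close: "\<And>y y' x. dist y y' \<le> 2 * \<epsilon> \<Longrightarrow> cmod (H y x - H y' x) \<le> \<omega>"
  shows "cmod ((LINT x|M. H x x) - (\<Sum>j<N. LINT x|M. bump \<epsilon> p j x * H (p j) x))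
    \<le> measure M (- K) + \<omega>"
proof -
  have [measurable]: "bump \<epsilon> p j \<in> borel_measurable M" "uncovered \<epsilon> p j \<in> borel_measurable M" for j
    by (intro continuous_borel_measurable continuous_intros)+
  note meas [measurable]
  have sp: "space M = UNIV" using pmp by (simp add: pmp_system_def)
  have \<omega>: "\<omega> \<ge> 0" using close[of "p 0" "p 0" "p 0"] \<epsilon> by simp
  have int: "integrable M (\<lambda>x. bump \<epsilon> p j x * H (p j) x)" for j
    by (rule integrable_bounded[of _ 1])
      (auto simp: norm_mult bump_bounds H_le_1 intro!: mult_le_one)
  have intH: "integrable M (\<lambda>x. H x x)" by (rule integrable_bounded[of _ 1]) (auto simp: H_le_1)
  have compl: "- K \<in> sets M" using K(1) sp by (metis Compl_eq_Diff_UNIV sets.compl_sets)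
  have int_ind: "integrable M (indicat_real (- K))"
    by (rule integrable_bounded[of _ 1]) (auto simp: indicator_def intro: borel_measurable_indicator[OF compl])
  have "(LINT x|M. H x x) - (\<Sum>j<N. LINT x|M. bump \<epsilon> p j x * H (p j) x)
      = (LINT x|M. H x x - (\<Sum>j<N. bump \<epsilon> p j x * H (p j) x))"
    using int intH by (simp add: Bochner_Integration.integral_sum)
  also have "cmod \<dots> \<le> (LINT x|M. indicat_real (- K) x + \<omega>)"
  proof (rule order_trans[OF integral_norm_bound], rule Bochner_Integration.integral_mono)
    show "integrable M (\<lambda>x. cmod (H x x - (\<Sum>j<N. bump \<epsilon> p j x * H (p j) x)))" using int intH by auto
    show "integrable M (\<lambda>x. indicat_real (- K) x + \<omega>)" using int_ind by simp
    fix x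
    have "complex_of_real (uncovered \<epsilon> p N x + (\<Sum>j<N. bump \<epsilon> p j x)) = 1" by (simp add: sum_bump)
    then have "H x x = (uncovered \<epsilon> p N x + (\<Sum>j<N. bump \<epsilon> p j x)) * H x x" by simp
    then have "H x x - (\<Sum>j<N. bump \<epsilon> p j x * H (p j) x)
        = uncovered \<epsilon> p N x * H x x + (\<Sum>j<N. bump \<epsilon> p j x * (H x x - H (p j) x))"
      by (simp add: algebra_simps sum_subtractf sum_distrib_left sum_distrib_right)
    also have "cmod \<dots> \<le> uncovered \<epsilon> p N x + (\<Sum>j<N. bump \<epsilon> p j x * \<omega>)"
    proof (rule order_trans[OF norm_triangle_ineq], rule add_mono)
      show "cmod (uncovered \<epsilon> p N x * H x x) \<le> uncovered \<epsilon> p N x"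
        using mult_left_mono[OF H_le_1 uncovered_bounds(1)[of \<epsilon> p N x], of x x] by (simp add: norm_mult uncovered_bounds)
      show "cmod (\<Sum>j<N. bump \<epsilon> p j x * (H x x - H (p j) x)) \<le> (\<Sum>j<N. bump \<epsilon> p j x * \<omega>)"
      proof (rule order_trans[OF norm_sum], rule sum_mono)
        fix j
        show "cmod (bump \<epsilon> p j x * (H x x - H (p j) x)) \<le> bump \<epsilon> p j x * \<omega>"
        proof (cases "tent \<epsilon> (p j) x = 0")
          case False
          then have "cmod (H x x - H (p j) x) \<le> \<omega>" using tent_nonzero_imp[OF \<epsilon>] by (intro close) auto
          then show ?thesis by (simp add: norm_mult bump_bounds mult_left_mono)
        qed (simp add: bump_def)
      qed
    qed
    also have "(\<Sum>j<N. bump \<epsilon> p j x * \<omega>) \<le> \<omega>"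
      unfolding sum_distrib_right[symmetric] sum_bump
      using uncovered_bounds[of \<epsilon> p N x] \<omega> by (simp add: mult_left_le_one_le)
    also have "uncovered \<epsilon> p N x \<le> indicat_real (- K) x"
      using K(2)[of x] uncovered_eq_0[OF \<epsilon>, of _ N x p] uncovered_bounds[of \<epsilon> p N x]
      by (cases "x \<in> K") auto
    finally show "cmod (H x x - (\<Sum>j<N. bump \<epsilon> p j x * H (p j) x)) \<le> indicat_real (- K) x + \<omega>" by simp
  qed
  also have "\<dots> = measure M (- K) + \<omega>"
    using int_ind prob_space by (simp add: sp)
  finally show ?thesis .
qed

text \<open>A bump is a product of \<open>j + 1\<close> tents or complements of tents at time 0, and
  \<open>F\<close> with frozen parameter is a product of exponentials at times from \<open>g\<close>
  on: exactly a past and a future separated by a gap.\<close>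

lemma bump_decorrelation:
  assumes dec: "decorrelates M T \<alpha> C \<delta>" and C: "C > 0" "0 < \<delta>" and \<alpha>: "0 < \<alpha>" "\<alpha> \<le> 1"
    and \<epsilon>: "0 < \<epsilon>" "\<epsilon> \<le> 1" and g: "g > 0" and j: "j < N" and L: "L \<ge> 0"
    and hL: "\<And>z z'. \<bar>h (p j) z - h (p j) z'\<bar> \<le> L * dist z z' powr \<alpha>"
  shows "cmod ((LINT x|M. bump \<epsilon> p j x * F s g n (p j) x) - (LINT x|M. bump \<epsilon> p j x * G s g n (p j)))
    \<le> C * (1 + real N * (1 / \<epsilon>) + real n * (\<bar>s\<bar> * L)) * \<delta> ^ g"
proof -
  let ?u = "\<lambda>i x. complex_of_real (if i < j then 1 - tent \<epsilon> (p i) x else tent \<epsilon> (p i) x)"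
  let ?v = "\<lambda>x. iexp (s * h (p j) x)"
  have v: "dist (?v x) (?v y) \<le> (\<bar>s\<bar> * L) * dist x y powr \<alpha>" for x y
  proof -
    have "dist (?v x) (?v y) \<le> \<bar>s * h (p j) x - s * h (p j) y\<bar>"
      unfolding dist_norm by (rule cmod_iexp_diff_le)
    also have "\<dots> = \<bar>s\<bar> * \<bar>h (p j) x - h (p j) y\<bar>" by (metis abs_mult right_diff_distrib)
    also have "\<dots> \<le> \<bar>s\<bar> * (L * dist x y powr \<alpha>)" by (intro mult_left_mono hL) auto
    finally show ?thesis by (simp add: mult_ac)
  qed
  have u: "dist (?u i x) (?u i y) \<le> (1 / \<epsilon>) * dist x y powr \<alpha>" for i x y
  proof -
    have "dist (?u i x) (?u i y) = \<bar>tent \<epsilon> (p i) x - tent \<epsilon> (p i) y\<bar>"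
      by (simp add: dist_norm abs_minus_commute flip: of_real_diff)
    then show ?thesis using tent_hoelder[OF \<epsilon> \<alpha>, of "p i" x y] by simp
  qed
  have "cmod (Cov M (\<lambda>x. \<Prod>i<Suc j. ?u i ((T ^^ 0) x)) (\<lambda>x. \<Prod>k<n - g. ?v ((T ^^ (g + k)) x)))
      \<le> C * (1 + (\<Sum>i<Suc j. 1 / \<epsilon>) + (\<Sum>k<n - g. \<bar>s\<bar> * L)) * \<delta> ^ g"
  proof (rule decorrelatesD[OF dec, where l = "\<lambda>i. 0" and k = "\<lambda>k. g + k" and u = ?u and v = "\<lambda>k. ?v"])
    show "cmod (?u i x) \<le> 1" for i x
      using tent_bounds[of \<epsilon> "p i" x] by (simp add: norm_of_real)
  qed (use u v g in \<open>auto simp: mono_on_def\<close>)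
  also have "\<dots> \<le> C * (1 + real N * (1 / \<epsilon>) + real n * (\<bar>s\<bar> * L)) * \<delta> ^ g"
  proof -
    have "real (Suc j) * (1 / \<epsilon>) \<le> real N * (1 / \<epsilon>)" using j \<epsilon> by (intro mult_right_mono) auto
    moreover have "real (n - g) * (\<bar>s\<bar> * L) \<le> real n * (\<bar>s\<bar> * L)" using L by (intro mult_right_mono) auto
    ultimately show ?thesis using C by (intro mult_right_mono mult_left_mono) auto
  qed
  also have "(\<lambda>x. \<Prod>i<Suc j. ?u i ((T ^^ 0) x)) = (\<lambda>x. complex_of_real (bump \<epsilon> p j x))"
    by (simp add: bump_def fun_eq_iff)
  also have "(\<lambda>x. \<Prod>k<n - g. ?v ((T ^^ (g + k)) x)) = F s g n (p j)"
    by (simp add: F_def sum_distrib_left exp_sum fun_eq_iff)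
  finally show ?thesis unfolding Cov_def G_def by simp
qed

text \<open>The chain \<open>I0\<close> to \<open>I5\<close> drops the first \<open>g\<close> terms,
  localises the parameter, decorrelates each cell, then removes the localisation and restores the
  terms. Every step but the middle one occurs twice, hence the factors 2.\<close>

lemma decoupling_estimate:
  assumes dec: "decorrelates M T \<alpha> C \<delta>" and C: "C > 0" "0 < \<delta>" and \<alpha>: "0 < \<alpha>" "\<alpha> \<le> 1"
    and \<epsilon>: "0 < \<epsilon>" "\<epsilon> \<le> 1" and g: "g > 0" "g \<le> n" and L: "L \<ge> 0"
    and K: "K \<in> sets M" "\<And>x. x \<in> K \<Longrightarrow> \<exists>j<N. dist x (p j) \<le> \<epsilon>" "\<And>j. j < N \<Longrightarrow> p j \<in> K"
    and hL: "\<And>y z z'. y \<in> K \<Longrightarrow> \<bar>h y z - h y z'\<bar> \<le> L * dist z z' powr \<alpha>"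
  shows "cmod ((LINT x|M. F s 0 n x x) - (LINT y|M. G s 0 n y))
    \<le> 2 * measure M (- K) + 2 * (\<bar>s\<bar> * real g) + 2 * (\<bar>s\<bar> * (real n * (D * (2 * \<epsilon>) powr \<gamma>)))
      + real N * (C * (1 + real N * (1 / \<epsilon>) + real n * (\<bar>s\<bar> * L)) * \<delta> ^ g)"
proof -
  define \<omega> where "\<omega> = \<bar>s\<bar> * (real n * (D * (2 * \<epsilon>) powr \<gamma>))"
  define err where "err = C * (1 + real N * (1 / \<epsilon>) + real n * (\<bar>s\<bar> * L)) * \<delta> ^ g"
  define I0 I1 I2 I3 I4 I5 where
    "I0 = (LINT x|M. F s 0 n x x)" and "I1 = (LINT x|M. F s g n x x)"
    and "I2 = (\<Sum>j<N. LINT x|M. bump \<epsilon> p j x * F s g n (p j) x)"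
    and "I3 = (\<Sum>j<N. LINT x|M. bump \<epsilon> p j x * G s g n (p j))"
    and "I4 = (LINT y|M. G s g n y)" and "I5 = (LINT y|M. G s 0 n y)"
  have G_integrable: "integrable M (G s k n)" for k
    by (rule integrable_bounded[of _ 1]) (auto simp: cmod_G)
  have "I0 - I1 = (LINT x|M. F s 0 n x x - F s g n x x)"
    unfolding I0_def I1_def using F_integrable by simp
  then have 1: "cmod (I0 - I1) \<le> \<bar>s\<bar> * real g"
    by (simp only:) (rule integral_norm_le, auto intro: F_gap[OF g(2)])
  have 2: "cmod (I1 - I2) \<le> measure M (- K) + \<omega>"
    unfolding I1_def I2_def
    by (rule partition_estimate[OF \<epsilon>(1) K(1,2)]) (auto simp: cmod_F \<omega>_def intro: F_param)
  have 3: "cmod (I2 - I3) \<le> real N * err"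
  proof -
    have "cmod (I2 - I3) \<le> (\<Sum>j<N. err)"
      unfolding I2_def I3_def sum_subtractf[symmetric]
    proof (rule order_trans[OF norm_sum], rule sum_mono)
      fix j assume "j \<in> {..<N}"
      then show "cmod ((LINT x|M. bump \<epsilon> p j x * F s g n (p j) x) - (LINT x|M. bump \<epsilon> p j x * G s g n (p j))) \<le> err"
        unfolding err_def using K(3)[of j] hL
        by (intro bump_decorrelation[OF dec C \<alpha> \<epsilon> g(1) _ L]) auto
    qed
    then show ?thesis by simp
  qed
  have 4: "cmod (I4 - I3) \<le> measure M (- K) + \<omega>"
    unfolding I4_def I3_def
    by (rule partition_estimate[OF \<epsilon>(1) K(1,2), where H = "\<lambda>y x. G s g n y"]) (auto simp: cmod_G \<omega>_def intro: G_param)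
  have "I5 - I4 = (LINT y|M. G s 0 n y - G s g n y)"
    unfolding I4_def I5_def using G_integrable by simp
  then have 5: "cmod (I5 - I4) \<le> \<bar>s\<bar> * real g"
    by (simp only:) (rule integral_norm_le, auto intro: G_gap[OF g(2)])
  have "I0 - I5 = (I0 - I1) + (I1 - I2) + (I2 - I3) - (I4 - I3) - (I5 - I4)" by simp
  then have "cmod (I0 - I5) \<le> cmod (I0 - I1) + cmod (I1 - I2) + cmod (I2 - I3) + cmod (I4 - I3) + cmod (I5 - I4)"
    by (simp only:) (intro order_trans[OF norm_triangle_ineq] order_trans[OF norm_triangle_ineq4] add_mono order_refl)
  then have "cmod (I0 - I5) \<le> 2 * measure M (- K) + 2 * (\<bar>s\<bar> * real g) + 2 * \<omega> + real N * err"
    using 1 2 3 4 5 by linarith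
  then show ?thesis unfolding I0_def I5_def \<omega>_def err_def .
qed

text \<open>Each \<open>y\<close> uses the exponent of some \<open>regular m\<close> containing it,
  and the decorrelation constants for that exponent.\<close>

lemma G_tendsto:
  "(\<lambda>n. G (t / sqrt (real n)) 0 n y)
     \<longlonglongrightarrow> complex_of_real (exp (- (1 / 2) * asymptotic_variance M T (h y) * t\<^sup>2))"
  and asymptotic_variance_h_scale:
  "asymptotic_variance M T (\<lambda>x. c * h y x) = c\<^sup>2 * asymptotic_variance M T (h y)"
proof -
  obtain m where m: "y \<in> regular m" using Union_regular by blast
  obtain C \<delta> where C: "C > 0" "0 < \<delta>" "\<delta> < 1" "decorrelates M T (1 / real (Suc m)) C \<delta>"
    using multiple_decorrelation_decorrelates[OF md _ nontrivial, of "1 / real (Suc m)"] by auto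
  interpret decorrelated_observable M T "h y" "1 / real (Suc m)" "real (Suc m)" C \<delta>
    by unfold_locales (use C h_le_1 regularD[OF m] h_centered in auto)
  have "G s 0 n y = char s n" for s n
    by (simp add: G_def F_def char_def S_def)
  then show "(\<lambda>n. G (t / sqrt (real n)) 0 n y)
     \<longlonglongrightarrow> complex_of_real (exp (- (1 / 2) * asymptotic_variance M T (h y) * t\<^sup>2))"
    using central_limit[of t] by simp
  show "asymptotic_variance M T (\<lambda>x. c * h y x) = c\<^sup>2 * asymptotic_variance M T (h y)"
    by (rule asymptotic_variance_scale)
qed

lemma decoupling_on_piece:
  assumes K: "K \<in> sets M" "K \<subseteq> regular m" "polynomially_covered K"
  obtains err where "err \<longlonglongrightarrow> 0"
    "\<forall>\<^sub>F n in sequentially. cmod ((LINT x|M. F (t / sqrt (real n)) 0 n x x)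
        - (LINT y|M. G (t / sqrt (real n)) 0 n y)) \<le> 2 * measure M (- K) + err n"
proof -
  define \<alpha> L where "\<alpha> = 1 / real (Suc m)" and "L = real (Suc m)"
  have \<alpha>: "0 < \<alpha>" "\<alpha> \<le> 1" and L: "L \<ge> 0" unfolding \<alpha>_def L_def by auto
  have hL: "\<bar>h y z - h y z'\<bar> \<le> L * dist z z' powr \<alpha>" if "y \<in> K" for y z z'
    unfolding \<alpha>_def L_def using K(2) that by (intro regularD) auto
  obtain C \<delta> where C: "C > 0" "0 < \<delta>" "\<delta> < 1" "decorrelates M T \<alpha> C \<delta>"
    using multiple_decorrelation_decorrelates[OF md \<alpha>(1) nontrivial] by auto
  obtain c d B where B: "B \<ge> 1" and net: "\<And>k::nat. k \<ge> 1 \<Longrightarrow> \<exists>N (p :: nat \<Rightarrow> 'a). N \<le> c * k ^ d \<and>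
      (\<forall>j<N. p j \<in> K) \<and> (\<forall>x\<in>K. \<exists>j<N. dist x (p j) \<le> B / real k)"
    by (rule polynomially_covered_net[OF K(3)]) (rule that)
  \<comment> \<open>With \<open>a * \<gamma> \<ge> 1\<close> and radius \<open>B / n ^ a\<close>,
    freezing changes each term by O(1/n), hence the sum of n terms by O(1) and the exponent by O(1 /
    sqrt n).\<close>
  obtain a :: nat where a: "1 / \<gamma> \<le> real a" using real_arch_simple by blast
  have "0 < 1 / \<gamma>" using \<gamma>_pos by simp
  then have a1: "a \<ge> 1" using a by linarith
  have a\<gamma>: "1 \<le> real a * \<gamma>" using a \<gamma>_pos by (simp add: divide_le_eq)
  \<comment> \<open>The first \<open>a * d\<close> counts the cells. The bracket bounds the constant
    per cell, where the tents contribute \<open>a * d + a\<close> and the exponentials a single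
    power of \<open>n\<close>.\<close>
  define q where "q = a * d + (a * d + a + 1)"
  define E where "E = real c * (C * (1 + real c + \<bar>t\<bar> * L))"
  define err where "err n = 2 * \<bar>t\<bar> * (real (gap n) / sqrt (real n))
      + 2 * \<bar>t\<bar> * D * (2 * B) powr \<gamma> * (1 / sqrt (real n)) + E * (real n ^ q * \<delta> ^ gap n)" for n
  have "(\<lambda>n. 1 / sqrt (real n)) \<longlonglongrightarrow> 0" by real_asymp
  then have "err \<longlonglongrightarrow> 2 * \<bar>t\<bar> * 0 + 2 * \<bar>t\<bar> * D * (2 * B) powr \<gamma> * 0 + E * 0"
    unfolding err_def[abs_def]
    by (intro tendsto_intros gap_over_sqrt_tendsto power_times_power_gap_tendsto C)
  then have err0: "err \<longlonglongrightarrow> 0" by simp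
  have "cmod ((LINT x|M. F (t / sqrt (real n)) 0 n x x) - (LINT y|M. G (t / sqrt (real n)) 0 n y))
      \<le> 2 * measure M (- K) + err n" if n: "n > 0" "B \<le> real n" for n :: nat
  proof -
    define s where "s = t / sqrt (real n)"
    define \<epsilon> where "\<epsilon> = B / real (n ^ a)"
    have n1: "real n \<ge> 1" using n by simp
    have abs_s: "\<bar>s\<bar> = \<bar>t\<bar> / sqrt (real n)" unfolding s_def by simp
    have s_le: "\<bar>s\<bar> \<le> \<bar>t\<bar>" unfolding abs_s using n1 by (simp add: divide_le_eq mult_le_cancel_left1)
    have "real n ^ 1 \<le> real n ^ a" using n1 a1 by (intro power_increasing) auto
    then have na: "real n \<le> real (n ^ a)" by simp
    have \<epsilon>: "0 < \<epsilon>" "\<epsilon> \<le> 1"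
    proof -
      have "B \<le> real (n ^ a)" using n na by linarith
      then show "0 < \<epsilon>" "\<epsilon> \<le> 1" unfolding \<epsilon>_def using B n by (auto simp: divide_le_eq)
    qed
    have inv\<epsilon>: "1 / \<epsilon> \<le> real n ^ a"
      unfolding \<epsilon>_def using B n by (simp add: divide_le_eq mult_le_cancel_left1)
    have "n ^ a \<ge> 1" using n by simp
    then obtain N p where N: "N \<le> c * (n ^ a) ^ d" and p: "\<And>j. j < N \<Longrightarrow> p j \<in> K"
        "\<And>x. x \<in> K \<Longrightarrow> \<exists>j<N. dist x (p j) \<le> \<epsilon>"
      using net[of "n ^ a"] unfolding \<epsilon>_def by blast
    have N': "real N \<le> real c * real n ^ (a * d)"
      using of_nat_mono[OF N, where ?'a = real] by (simp add: power_mult)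
    have est: "cmod ((LINT x|M. F s 0 n x x) - (LINT y|M. G s 0 n y))
      \<le> 2 * measure M (- K) + 2 * (\<bar>s\<bar> * real (gap n)) + 2 * (\<bar>s\<bar> * (real n * (D * (2 * \<epsilon>) powr \<gamma>)))
        + real N * (C * (1 + real N * (1 / \<epsilon>) + real n * (\<bar>s\<bar> * L)) * \<delta> ^ gap n)"
      by (rule decoupling_estimate[OF C(4,1,2) \<alpha> \<epsilon> gap_pos[OF n(1)] gap_le L K(1) p(2) p(1) hL])
    have 1: "2 * (\<bar>s\<bar> * real (gap n)) = 2 * \<bar>t\<bar> * (real (gap n) / sqrt (real n))"
      unfolding abs_s by simp
    have 2: "2 * (\<bar>s\<bar> * (real n * (D * (2 * \<epsilon>) powr \<gamma>))) \<le> 2 * \<bar>t\<bar> * D * (2 * B) powr \<gamma> * (1 / sqrt (real n))"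
    proof -
      have "real n powr 1 \<le> real n powr (real a * \<gamma>)" using n1 a\<gamma> by (intro powr_mono) auto
      then have "real n \<le> (real n ^ a) powr \<gamma>"
        using n1 by (simp add: powr_powr flip: powr_realpow)
      then have "(2 * \<epsilon>) powr \<gamma> \<le> (2 * B) powr \<gamma> / real n"
        unfolding \<epsilon>_def using B n1 by (simp add: powr_divide frac_le)
      then have "real n * (D * (2 * \<epsilon>) powr \<gamma>) \<le> real n * (D * ((2 * B) powr \<gamma> / real n))"
        using D_nonneg by (intro mult_left_mono) auto
      also have "\<dots> = D * (2 * B) powr \<gamma>" using n1 by simp
      finally have "2 * (\<bar>s\<bar> * (real n * (D * (2 * \<epsilon>) powr \<gamma>))) \<le> 2 * (\<bar>s\<bar> * (D * (2 * B) powr \<gamma>))"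
        by (intro mult_left_mono) auto
      then show ?thesis unfolding abs_s by simp
    qed
    have 3: "real N * (C * (1 + real N * (1 / \<epsilon>) + real n * (\<bar>s\<bar> * L)) * \<delta> ^ gap n) \<le> E * (real n ^ q * \<delta> ^ gap n)"
    proof -
      define P where "P = real n ^ (a * d + a + 1)"
      have P: "1 \<le> P" "real n ^ (a * d + a) \<le> P" "real n \<le> P"
        unfolding P_def using n1 power_increasing[of 1 "a * d + a + 1" "real n"]
          one_le_power[OF n1, of "a * d + a + 1"] power_increasing[of "a * d + a" "a * d + a + 1" "real n"]
        by simp_all
      have "real N * (1 / \<epsilon>) \<le> (real c * real n ^ (a * d)) * real n ^ a"
        using N' inv\<epsilon> \<epsilon> by (intro mult_mono) auto
      also have "\<dots> = real c * real n ^ (a * d + a)" by (simp add: power_add)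
      also have "\<dots> \<le> P * real c" unfolding mult.commute[of P] using P(2) by (intro mult_left_mono) auto
      finally have x: "real N * (1 / \<epsilon>) \<le> P * real c" .
      have y: "real n * (\<bar>s\<bar> * L) \<le> P * (\<bar>t\<bar> * L)"
        using P(3) s_le L by (intro mult_mono) auto
      have "1 + real N * (1 / \<epsilon>) + real n * (\<bar>s\<bar> * L) \<le> P * (1 + real c + \<bar>t\<bar> * L)"
        using x y P(1) by (simp add: distrib_left)
      then have "C * (1 + real N * (1 / \<epsilon>) + real n * (\<bar>s\<bar> * L)) * \<delta> ^ gap n \<le> C * (P * (1 + real c + \<bar>t\<bar> * L)) * \<delta> ^ gap n"
        using C by (intro mult_right_mono mult_left_mono) auto
      then have "real N * (C * (1 + real N * (1 / \<epsilon>) + real n * (\<bar>s\<bar> * L)) * \<delta> ^ gap n)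
          \<le> (real c * real n ^ (a * d)) * (C * (P * (1 + real c + \<bar>t\<bar> * L)) * \<delta> ^ gap n)"
        using C \<epsilon> L by (intro mult_mono[OF N']) auto
      also have "\<dots> = E * ((real n ^ (a * d) * P) * \<delta> ^ gap n)"
        unfolding E_def by (simp only: mult_ac)
      also have "real n ^ (a * d) * P = real n ^ q" unfolding P_def q_def by (simp only: power_add)
      finally show ?thesis .
    qed
    show ?thesis using est 1 2 3 unfolding err_def s_def[symmetric] by linarith
  qed
  moreover have "\<forall>\<^sub>F n in sequentially. n > 0 \<and> B \<le> real n"
    using eventually_gt_at_top[of 0] eventually_ge_at_top[of "nat \<lceil>B\<rceil>"]
    by eventually_elim linarith
  ultimately show ?thesis by (intro that[OF err0]) (auto elim: eventually_mono)
qed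

text \<open>The good set is fixed in terms of \<open>e\<close> before \<open>n\<close> grows, so its
  exponent, covering constants and decorrelation constants are constants in \<open>n\<close>. A
  complement of measure below \<open>e / 4\<close> is counted twice, leaving \<open>e / 2\<close>
  for the vanishing error.\<close>

lemma decoupling:
  "(\<lambda>n. (LINT x|M. F (t / sqrt (real n)) 0 n x x) - (LINT y|M. G (t / sqrt (real n)) 0 n y)) \<longlonglongrightarrow> 0"
proof (rule tendstoI)
  fix e :: real assume e: "e > 0"
  have borel: "S \<in> sets M" if "S \<in> sets borel" for S using pmp that by (auto simp: pmp_system_def)
  define K where "K m = regular m \<inter> W m" for m
  have K_sets: "K m \<in> sets M" for m
    unfolding K_def using W(1) closed_regular by (intro sets.Int borel) auto
  have "incseq K"
    unfolding K_def using mono_regular W(3) by (auto simp: mono_def) blast+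
  moreover have "(\<Union>m. K m) = UNIV"
  proof -
    have "\<exists>m. x \<in> K m" for x
    proof -
      obtain i j where ij: "x \<in> regular i" "x \<in> W j" using Union_regular W(4) by blast
      then have "x \<in> K (max i j)"
        unfolding K_def using monoD[OF mono_regular, of i "max i j"] monoD[OF W(3), of j "max i j"] by auto
      then show ?thesis ..
    qed
    then show ?thesis by blast
  qed
  ultimately have "(\<lambda>m. measure M (K m)) \<longlonglongrightarrow> measure M UNIV"
    using finite_Lim_measure_incseq[of K] K_sets by auto
  moreover have sp: "space M = UNIV" using pmp by (simp add: pmp_system_def)
  ultimately have "(\<lambda>m. measure M (K m)) \<longlonglongrightarrow> 1" using prob_space by simp
  then have "\<forall>\<^sub>F m in sequentially. 1 - e / 4 < measure M (K m)"
    by (rule order_tendstoD) (use e in simp)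
  then obtain m where m: "1 - e / 4 < measure M (K m)"
    using eventually_happens sequentially_bot by blast
  have compl: "measure M (- K m) < e / 4"
    using prob_compl[OF K_sets[of m]] m by (simp add: sp Compl_eq_Diff_UNIV)
  obtain err where err: "err \<longlonglongrightarrow> 0"
    "\<forall>\<^sub>F n in sequentially. cmod ((LINT x|M. F (t / sqrt (real n)) 0 n x x)
        - (LINT y|M. G (t / sqrt (real n)) 0 n y)) \<le> 2 * measure M (- K m) + err n"
    using decoupling_on_piece[OF K_sets, of m m t] polynomially_covered_subset[OF W(2), of "K m" m]
    unfolding K_def by blast
  have "\<forall>\<^sub>F n in sequentially. err n < e / 2" using err(1) by (rule order_tendstoD) (use e in simp)
  with err(2) show "\<forall>\<^sub>F n in sequentially. dist ((LINT x|M. F (t / sqrt (real n)) 0 n x x)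
        - (LINT y|M. G (t / sqrt (real n)) 0 n y)) 0 < e"
    by eventually_elim (use compl in simp)
qed

text \<open>Measurability of the limit in the parameter is inherited from the continuous functions
  \<open>G\<close>, of which it is a pointwise limit.\<close>

lemma integral_F_diag_tendsto:
  "(\<lambda>n. LINT x|M. F (t / sqrt (real n)) 0 n x x)
     \<longlonglongrightarrow> complex_of_real (LINT x|M. exp (- (1 / 2) * asymptotic_variance M T (h x) * t\<^sup>2))"
proof -
  have meas: "(\<lambda>y. complex_of_real (exp (- (1 / 2) * asymptotic_variance M T (h y) * t\<^sup>2))) \<in> borel_measurable M"
    by (rule borel_measurable_LIMSEQ_metric[OF G_measurable G_tendsto])
  have "(\<lambda>n. LINT y|M. G (t / sqrt (real n)) 0 n y)
      \<longlonglongrightarrow> (LINT y|M. complex_of_real (exp (- (1 / 2) * asymptotic_variance M T (h y) * t\<^sup>2)))"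
    by (rule integral_dominated_convergence[where w = "\<lambda>_. 1"])
      (use meas G_tendsto cmod_G in auto)
  then have "(\<lambda>n. LINT y|M. G (t / sqrt (real n)) 0 n y)
      \<longlonglongrightarrow> complex_of_real (LINT y|M. exp (- (1 / 2) * asymptotic_variance M T (h y) * t\<^sup>2))"
    by (simp only: integral_complex_of_real)
  from tendsto_add[OF decoupling[of t] this] show ?thesis by simp
qed

end

section \<open>Normalisation and conclusion\<close>

lemma bdd_above_hoelder_quotientsE:
  assumes "bdd_above (hoelder_quotients \<eta> f)"
  obtains L where "L \<ge> 0" "\<And>x y. dist (f x) (f y) \<le> L * dist x y powr \<eta>"
proof -
  obtain L where L: "\<And>q. q \<in> hoelder_quotients \<eta> f \<Longrightarrow> q \<le> L"
    using assms by (auto simp: bdd_above_def)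
  show ?thesis
  proof (rule that[of "max L 0"])
    fix x y
    show "dist (f x) (f y) \<le> max L 0 * dist x y powr \<eta>"
    proof (cases "x = y")
      case False
      then have "dist (f x) (f y) / dist x y powr \<eta> \<le> L"
        by (intro L) (auto simp: hoelder_quotients_def)
      then have "dist (f x) (f y) \<le> L * dist x y powr \<eta>" using False by (simp add: divide_le_eq)
      also have "\<dots> \<le> max L 0 * dist x y powr \<eta>" by (intro mult_right_mono) auto
      finally show ?thesis .
    qed simp
  qed simp
qed

lemma hoelder_imp_continuous_on:
  fixes f :: "'a::metric_space \<Rightarrow> real"
  assumes "\<kappa> > 0" "\<And>x y. \<bar>f x - f y\<bar> \<le> L * dist x y powr \<kappa>"
  shows "continuous_on UNIV f"
proof -
  have "(f \<longlongrightarrow> f x) (at x)" for x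
  proof -
    have 0: "((\<lambda>y. dist y x) \<longlongrightarrow> 0) (at x)" by (simp flip: tendsto_dist_iff)
    have "((\<lambda>y. L * dist y x powr \<kappa>) \<longlongrightarrow> L * 0) (at x)"
      using tendsto_powr'[OF 0 tendsto_const, of \<kappa>] assms(1) by (intro tendsto_intros) auto
    then have lim: "((\<lambda>y. L * dist y x powr \<kappa>) \<longlongrightarrow> 0) (at x)" by simp
    have "((\<lambda>y. f y - f x) \<longlongrightarrow> 0) (at x)"
      by (rule Lim_null_comparison[OF _ lim]) (intro always_eventually allI, simp add: assms(2))
    then show ?thesis by (simp add: LIM_zero_iff)
  qed
  then show ?thesis by (simp add: continuous_on_def)
qed

theorem theorem3p3:
  fixes A :: "('a::{metric_space, second_countable_topology}, 'e::euclidean_space) chart set"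
    and g :: "('a, 'e) chart \<Rightarrow> 'a \<Rightarrow> 'e \<Rightarrow> 'e \<Rightarrow> real"
    and M :: "'a measure"
    and T :: "'a \<Rightarrow> 'a"
    and \<theta> :: "'a \<Rightarrow> 'a \<Rightarrow> 'a"
    and \<eta> C t :: real
    and \<phi> :: "'a \<Rightarrow> real"
  assumes "riemannian_manifold A g"
    and "pmp_system M T"
    and "multiple_decorrelation M T"
    and "\<And>x. hoelder_map (\<theta> x)"
    and "\<eta> > 0" and "C > 0"
    and "\<And>x y z. dist (\<theta> x z) (\<theta> y z) \<le> C * dist x y powr \<eta>"
    and "hoelder_continuous \<phi>"
    and "(LINT x|M. \<phi> x) = 0"
  shows "(\<lambda>n. LINT x|M. exp (\<i> * complex_of_real
             (t / sqrt (real n) * (\<Sum>k<n. (\<phi> (\<theta> x ((T ^^ k) x)) - space_mean M \<phi> (\<theta> x))))))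
         \<longlonglongrightarrow>
         complex_of_real
           (LINT x|M. exp (- (1 / 2) * asymptotic_variance M T (centered_comp M \<phi> (\<theta> x)) * t\<^sup>2))"
proof -
  interpret pmp_dynamics M T using assms(2) by unfold_locales
  obtain \<beta> where \<beta>: "\<beta> > 0" "hoelder \<beta> \<phi>" using assms(8) by (auto simp: hoelder_continuous_def)
  have "bdd_above (hoelder_quotients \<beta> \<phi>)" using \<beta>(2) by (simp add: hoelder_def)
  then obtain H where H: "H \<ge> 0" "\<And>x y. dist (\<phi> x) (\<phi> y) \<le> H * dist x y powr \<beta>"
    by (rule bdd_above_hoelder_quotientsE) (rule that)
  obtain B0 where "\<And>x. \<bar>\<phi> x\<bar> \<le> B0" using \<beta>(2) by (auto simp: hoelder_def bdd_above_def)
  then have "\<exists>B>0. \<forall>x. \<bar>\<phi> x\<bar> \<le> B" by (intro exI[of _ "max B0 1"]) (auto simp: le_max_iff_disj)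
  then obtain B where B: "B > 0" "\<And>x. \<bar>\<phi> x\<bar> \<le> B" by blast
  \<comment> \<open>The exponent of the composition is \<open>\<alpha> * \<beta>\<close>, where
    \<open>\<alpha>\<close> belongs to \<open>\<theta> y\<close>; this is the source of the
    exponents varying with the parameter.\<close>
  have comp_hoelder: "\<exists>\<kappa>>0. \<exists>L. \<forall>z z'. \<bar>\<phi> (\<theta> y z) - \<phi> (\<theta> y z')\<bar> \<le> L * dist z z' powr \<kappa>" for y
  proof -
    obtain \<alpha> where \<alpha>: "\<alpha> > 0" "bdd_above (hoelder_quotients \<alpha> (\<theta> y))"
      using assms(4)[of y] by (auto simp: hoelder_map_def)
    obtain L where L: "L \<ge> 0" "\<And>z z'. dist (\<theta> y z) (\<theta> y z') \<le> L * dist z z' powr \<alpha>"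
      using \<alpha>(2) by (rule bdd_above_hoelder_quotientsE) (rule that)
    have "\<bar>\<phi> (\<theta> y z) - \<phi> (\<theta> y z')\<bar> \<le> (H * L powr \<beta>) * dist z z' powr (\<alpha> * \<beta>)" for z z'
    proof -
      have "\<bar>\<phi> (\<theta> y z) - \<phi> (\<theta> y z')\<bar> \<le> H * dist (\<theta> y z) (\<theta> y z') powr \<beta>"
        using H(2) by (simp add: dist_real_def)
      also have "\<dots> \<le> H * (L * dist z z' powr \<alpha>) powr \<beta>"
        using H(1) L(2) \<beta>(1) by (intro mult_left_mono powr_mono2) auto
      finally show ?thesis using L(1) by (simp add: powr_mult powr_powr mult.assoc)
    qed
    then show ?thesis using \<alpha>(1) \<beta>(1) by (intro exI[of _ "\<alpha> * \<beta>"]) auto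
  qed
  have comp_borel [measurable]: "(\<lambda>z. \<phi> (\<theta> y z)) \<in> borel_measurable M" for y
    using comp_hoelder[of y] by (blast intro: continuous_borel_measurable hoelder_imp_continuous_on)
  have comp_integrable: "integrable M (\<lambda>z. \<phi> (\<theta> y z))" for y
    by (rule integrable_bounded[of _ B]) (auto simp: B)
  define P where "P = H * C powr \<beta>"
  have P: "P \<ge> 0" unfolding P_def using H by simp
  have comp_param: "\<bar>\<phi> (\<theta> y z) - \<phi> (\<theta> y' z)\<bar> \<le> P * dist y y' powr (\<eta> * \<beta>)" for y y' z
  proof -
    have "\<bar>\<phi> (\<theta> y z) - \<phi> (\<theta> y' z)\<bar> \<le> H * dist (\<theta> y z) (\<theta> y' z) powr \<beta>"
      using H(2) by (simp add: dist_real_def)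
    also have "\<dots> \<le> H * (C * dist y y' powr \<eta>) powr \<beta>"
      using H(1) assms(7) \<beta>(1) by (intro mult_left_mono powr_mono2) auto
    finally show ?thesis unfolding P_def using assms(6) by (simp add: powr_mult powr_powr mult.assoc)
  qed
  have mean_le: "\<bar>space_mean M \<phi> (\<theta> y)\<bar> \<le> B" for y
    unfolding space_mean_def real_norm_def[symmetric] by (rule integral_norm_le) (use B in \<open>auto simp: less_imp_le\<close>)
  have mean_param: "\<bar>space_mean M \<phi> (\<theta> y) - space_mean M \<phi> (\<theta> y')\<bar> \<le> P * dist y y' powr (\<eta> * \<beta>)" for y y'
  proof -
    have "space_mean M \<phi> (\<theta> y) - space_mean M \<phi> (\<theta> y') = (LINT z|M. \<phi> (\<theta> y z) - \<phi> (\<theta> y' z))"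
      unfolding space_mean_def using comp_integrable by simp
    moreover have "norm (LINT z|M. \<phi> (\<theta> y z) - \<phi> (\<theta> y' z)) \<le> P * dist y y' powr (\<eta> * \<beta>)"
      by (rule integral_norm_le) (use comp_param P in auto)
    ultimately show ?thesis by simp
  qed
  \<comment> \<open>The observable and its mean are both bounded by \<open>B\<close>, so division by
    \<open>2 * B\<close> brings the centered observable into [-1, 1].\<close>
  define h where "h y z = centered_comp M \<phi> (\<theta> y) z / (2 * B)" for y z
  obtain W :: "nat \<Rightarrow> 'a set"
    where W: "\<And>n. open (W n)" "\<And>n. polynomially_covered (W n)" "mono W" "(\<Union>n. W n) = UNIV"
    by (rule riemannian_manifold_exhaustion[OF assms(1)]) (rule that)
  obtain a b :: 'a where ab: "a \<noteq> b" by (rule riemannian_manifold_not_singleton[OF assms(1)])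
  \<comment> \<open>The 2 in the numerator appears because the composition and its mean each vary by
    \<open>P\<close> times the power of the distance.\<close>
  interpret observable_family M T h "2 * P / (2 * B)" "\<eta> * \<beta>" W a b
  proof
    show "\<bar>h y z\<bar> \<le> 1" for y z
    proof -
      have "\<bar>\<phi> (\<theta> y z) - space_mean M \<phi> (\<theta> y)\<bar> \<le> 2 * B"
        using B(2)[of "\<theta> y z"] mean_le[of y] by linarith
      then show ?thesis unfolding h_def centered_comp_def using B(1) by (simp add: divide_le_eq)
    qed
    show "\<exists>\<kappa>>0. \<exists>L. \<forall>z z'. \<bar>h y z - h y z'\<bar> \<le> L * dist z z' powr \<kappa>" for y
    proof -
      obtain \<kappa> L where \<kappa>: "\<kappa> > 0" "\<And>z z'. \<bar>\<phi> (\<theta> y z) - \<phi> (\<theta> y z')\<bar> \<le> L * dist z z' powr \<kappa>"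
        using comp_hoelder by blast
      have "\<bar>h y z - h y z'\<bar> \<le> (L / (2 * B)) * dist z z' powr \<kappa>" for z z'
      proof -
        have "\<bar>h y z - h y z'\<bar> = \<bar>\<phi> (\<theta> y z) - \<phi> (\<theta> y z')\<bar> / (2 * B)"
          unfolding h_def centered_comp_def using B(1) by (simp flip: diff_divide_distrib)
        also have "\<dots> \<le> (L * dist z z' powr \<kappa>) / (2 * B)"
          using \<kappa>(2) B(1) by (intro divide_right_mono) auto
        finally show ?thesis by simp
      qed
      then show ?thesis using \<kappa>(1) by blast
    qed
    show "\<bar>h y z - h y' z\<bar> \<le> 2 * P / (2 * B) * dist y y' powr (\<eta> * \<beta>)" for y y' z
    proof -
      have "\<bar>h y z - h y' z\<bar> = \<bar>(\<phi> (\<theta> y z) - \<phi> (\<theta> y' z)) - (space_mean M \<phi> (\<theta> y) - space_mean M \<phi> (\<theta> y'))\<bar> / (2 * B)"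
        unfolding h_def centered_comp_def using B(1) by (simp add: algebra_simps flip: diff_divide_distrib)
      also have "\<dots> \<le> (2 * (P * dist y y' powr (\<eta> * \<beta>))) / (2 * B)"
        using comp_param[of y z y'] mean_param[of y y'] B(1) by (intro divide_right_mono) linarith+
      finally show ?thesis by simp
    qed
    show "(LINT z|M. h y z) = 0" for y
    proof -
      have "(LINT z|M. \<phi> (\<theta> y z) - space_mean M \<phi> (\<theta> y)) = 0"
        using comp_integrable[of y] by (simp add: prob_space space_mean_def)
      then show ?thesis unfolding h_def centered_comp_def by simp
    qed
  qed (use assms W ab B P \<beta> in auto)
  \<comment> \<open>The normalisation is undone by evaluating at \<open>2 * B * t\<close>; the
    variance scales by the square of the same factor.\<close>
  have F_eq: "F (2 * B * t / sqrt (real n)) 0 n x x = exp (\<i> * complex_of_real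
      (t / sqrt (real n) * (\<Sum>k<n. (\<phi> (\<theta> x ((T ^^ k) x)) - space_mean M \<phi> (\<theta> x)))))" for n x
    unfolding F_def h_def centered_comp_def using B(1) by (simp flip: sum_divide_distrib)
  have "centered_comp M \<phi> (\<theta> x) = (\<lambda>z. (2 * B) * h x z)" for x
    unfolding h_def using B(1) by auto
  then have "asymptotic_variance M T (centered_comp M \<phi> (\<theta> x)) * t\<^sup>2
      = asymptotic_variance M T (h x) * (2 * B * t)\<^sup>2" for x
    by (simp only: asymptotic_variance_h_scale) (simp add: power_mult_distrib)
  then have var_eq: "- (1 / 2) * asymptotic_variance M T (h x) * (2 * B * t)\<^sup>2
      = - (1 / 2) * asymptotic_variance M T (centered_comp M \<phi> (\<theta> x)) * t\<^sup>2" for x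
    by simp
  show ?thesis
    using integral_F_diag_tendsto[of "2 * B * t"] unfolding F_eq var_eq .
qed

end
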